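(* Let $\mathbf{k}$ be a field, and let $X$ and $\Omega$ be totally ordered sets. With the notation fixed in the context: (1) The linear map $\eta:\mathbf{k}\,\mathrm{MNE}_{\mathrm{NC},\Omega}(X)\to \mathrm{Nov}_{\mathrm{NC},\Omega}(X)$, $u\mapsto u+J$ (for $u\in \mathrm{MNE}_{\mathrm{NC},\Omega}(X)$), is bijective. (2) The cosets modulo $J$ of the noncommuting multi-Novikov elements in $\mathrm{MNE}_{\mathrm{NC},\Omega}(X)$ form a linear basis of the free noncommuting multi-Novikov algebra $\mathrm{Nov}_{\mathrm{NC},\Omega}(X)$. (3) The noncommuting multi-Novikov algebra homomorphism $\bar f:\mathrm{Nov}_{\mathrm{NC},\Omega}(X)\to \mathrm{PCD}_{\mathrm{NC},\Omega}(X)$ determined by $r(x)+J\mapsto x$ for $x\in X$ is an isomorphism. (4) The space $\mathrm{PCD}_{\mathrm{NC},\Omega}(X)$, together with the operations $u\ast_\omega v=u\,D_\omega(v)$, $\omega\in\Omega$, is a free noncommuting multi-Novikov algebra on $X$.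
   Context: **Noncommuting multi-Novikov algebras.** A noncommuting multi-Novikov algebra (indexed by $\Omega$) is a $\mathbf{k}$-vector space $N$ with bilinear products $\rhd_\omega$, $\omega\in\Omega$, such that for all $x,y,z\in N$, $\omega,\tau\in\Omega$: $(x\rhd_\omega y)\rhd_\tau z-x\rhd_\omega(y\rhd_\tau z)=(y\rhd_\omega x)\rhd_\tau z-y\rhd_\omega(x\rhd_\tau z)$ and $(x\rhd_\omega y)\rhd_\tau z=(x\rhd_\tau z)\rhd_\omega y$. Homomorphisms are linear maps preserving all $\rhd_\omega$; "free on $X$" means the usual universal property with respect to set maps from $X$. **Trees and $\mathrm{Nov}_{\mathrm{NC},\Omega}(X)$.** $\mathrm{MT}_\Omega(X)$ is the set of typed decorated rooted trees (vertices decorated by $X$, edges by $\Omega$), encoded as $r$-expressions, defined recursively: $r(z)$ for $z\in X$ (a single vertex; identified with $z$, so $X\subset \mathrm{MT}_\Omega(X)$; this is the case $n=0$ below), and $r(y_1,\omega_1,\dots,y_n,\omega_n;z)$ for $n\ge 1$, $z\in X$ (the root), $\omega_i\in\Omega$, $y_i\in\mathrm{MT}_\Omega(X)$ (the ordered branches, $y_i$ being attached to the root by an edge decorated by $\omega_i$). The space $\mathbf{k}\mathrm{MT}_\Omega(X)$ with basis $\mathrm{MT}_\Omega(X)$ has bilinear products $\rhd_\omega$ given by $u\rhd_\omega r(y_1,\omega_1,\dots,y_n,\omega_n;z)=r(u,\omega,y_1,\omega_1,\dots,y_n,\omega_n;z)$ and $u\rhd_\omega r(z)=r(u,\omega;z)$.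 $J$ is the two-sided ideal of $(\mathbf{k}\mathrm{MT}_\Omega(X),\{\rhd_\omega\}_{\omega\in\Omega})$ (subspace stable under left and right multiplication by all elements via all $\rhd_\omega$) generated by all elements $(x\rhd_\omega y)\rhd_\tau z-x\rhd_\omega(y\rhd_\tau z)-(y\rhd_\omega x)\rhd_\tau z+y\rhd_\omega(x\rhd_\tau z)$ and $(x\rhd_\omega y)\rhd_\tau z-(x\rhd_\tau z)\rhd_\omega y$, with $x,y,z\in\mathbf{k}\mathrm{MT}_\Omega(X)$, $\omega,\tau\in\Omega$. Put $\mathrm{Nov}_{\mathrm{NC},\Omega}(X):=\mathbf{k}\mathrm{MT}_\Omega(X)/J$ with the induced products; it is the free noncommuting multi-Novikov algebra on $X$ via $x\mapsto r(x)+J$. **Noncommuting multi-Novikov elements.** An $r$-expression $u$ is a *nest* if $u\in X$, or $u=r(y_1,\omega_1,\dots,y_n,\omega_n;z)$ with $n\ge1$, $y_i\in X$ for $i\ge2$ and $y_1$ itself a nest. A nest $u=r(y_1,\omega_1,\dots,y_n,\omega_n;z)$ is called *ordered* if it satisfies one of the following conditions: (i) $n=0$, in which case $u\in X$; (ii) $n>0$ and $y_1\in X$; (iii) $n>0$, $y_1=r(y_1',\omega_1',\dots,y_m',\omega_m';z')$ and $m>n$; (iv) $n>0$, $y_1=r(y_1',\omega_1',\dots,y_m',\omega_m';z')$, $m=n$ and $z'>z$; (v) $n>0$, $y_1=r(y_1',\omega_1',\dots,y_m',\omega_m';z')$, $m=n$, $z'=z$ and $(\omega_1',\dots,\omega_n')\ge(\omega_1,\dots,\omega_n)$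 in the lexicographical order. The left-to-right leaf sequence $L(u)$ of a nest is: $L(z)=(z)$ for $z\in X$, and $L(r(y_1,\omega_1,\dots,y_n,\omega_n;z))$ is $L(y_1)$ followed by $y_2,\dots,y_n$. A *noncommuting multi-Novikov element* is an ordered nest $u$ whose leaf sequence, read from right to left, is (weakly) increasing in $X$. $\mathrm{MNE}_{\mathrm{NC},\Omega}(X)$ is the set of these; $\mathbf{k}\,\mathrm{MNE}_{\mathrm{NC},\Omega}(X)\subseteq\mathbf{k}\mathrm{MT}_\Omega(X)$ is its span. **Differential polynomials and $\mathrm{PCD}_{\mathrm{NC},\Omega}(X)$.** $\mathbf{k}_{\mathrm{NC},\Omega}\{X\}$ is the commutative polynomial algebra over $\mathbf{k}$ in the variables $(\partial_{\omega_1}\cdots\partial_{\omega_k})(x)$ indexed by pairs consisting of a word $\partial_{\omega_1}\cdots\partial_{\omega_k}$ ($k\ge0$, $\omega_i\in\Omega$) in the free (noncommutative) monoid on symbols $\partial_\omega$, and $x\in X$ (the empty word gives the variable $x$). For $\omega\in\Omega$, $D_\omega$ is the derivation with $D_\omega((\partial_{\omega_1}\cdots\partial_{\omega_k})(x))=(\partial_\omega\partial_{\omega_1}\cdots\partial_{\omega_k})(x)$. With $u\ast_\omega v:=u\,D_\omega(v)$, $\mathbf{k}_{\mathrm{NC},\Omega}\{X\}$ is a noncommuting multi-Novikov algebra; $\mathrm{PCD}_{\mathrm{NC},\Omega}(X)$ is its noncommuting multi-Novikov subalgebra generated by $X$.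
   Formalization: "Ordered" is required at every level of the nest (y_1 must itself be ordered), since with (i)–(v) imposed only at the root distinct elements such as r(r(r(x,ω;z1),ω;z2),ω;z1) and r(r(r(x,ω;z2),ω;z1),ω;z1), z1<z2, agree modulo J; X and Ω are taken nonempty. *)

theory Defs
  imports Complex_Main "HOL-Library.Poly_Mapping"
begin

section \<open>Noncommuting multi-Novikov algebras\<close>

locale nc_multi_novikov = vector_space scale
  for scale :: "'k::field \<Rightarrow> 'n::ab_group_add \<Rightarrow> 'n" +
  fixes tri :: "'o \<Rightarrow> 'n \<Rightarrow> 'n \<Rightarrow> 'n"
  assumes linear_right: "Vector_Spaces.linear scale scale (\<lambda>y. tri w x y)"
    and linear_left: "Vector_Spaces.linear scale scale (\<lambda>x. tri w x y)"
    and left_symmetric: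
      "tri t (tri w x y) z - tri w x (tri t y z) = tri t (tri w y x) z - tri w y (tri t x z)"
    and right_commutative:
      "tri t (tri w x y) z = tri w (tri t x z) y"

definition nmn_hom ::
  "('k::field \<Rightarrow> 'a::ab_group_add \<Rightarrow> 'a) \<Rightarrow> ('o \<Rightarrow> 'a \<Rightarrow> 'a \<Rightarrow> 'a) \<Rightarrow>
   ('k \<Rightarrow> 'b::ab_group_add \<Rightarrow> 'b) \<Rightarrow> ('o \<Rightarrow> 'b \<Rightarrow> 'b \<Rightarrow> 'b) \<Rightarrow> ('a \<Rightarrow> 'b) \<Rightarrow> bool" where
  "nmn_hom scale1 tri1 scale2 tri2 h \<longleftrightarrow>
     Vector_Spaces.linear scale1 scale2 h \<and>
     (\<forall>w x y. h (tri1 w x y) = tri2 w (h x) (h y))"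

definition nmn_iso ::
  "('k::field \<Rightarrow> 'a::ab_group_add \<Rightarrow> 'a) \<Rightarrow> ('o \<Rightarrow> 'a \<Rightarrow> 'a \<Rightarrow> 'a) \<Rightarrow>
   ('k \<Rightarrow> 'b::ab_group_add \<Rightarrow> 'b) \<Rightarrow> ('o \<Rightarrow> 'b \<Rightarrow> 'b \<Rightarrow> 'b) \<Rightarrow> ('a \<Rightarrow> 'b) \<Rightarrow> bool" where
  "nmn_iso scale1 tri1 scale2 tri2 h \<longleftrightarrow> nmn_hom scale1 tri1 scale2 tri2 h \<and> bij h"

text \<open>
  The universal property with respect to all target algebras whose underlying type is \<open>'m\<close>.
  HOL cannot quantify over types inside a formula; a theorem that is polymorphic in \<open>'m\<close>
  expresses freeness with respect to all targets.
\<close>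

definition free_nc_multi_novikov ::
  "'m::ab_group_add itself \<Rightarrow> ('k::field \<Rightarrow> 'n::ab_group_add \<Rightarrow> 'n) \<Rightarrow>
   ('o \<Rightarrow> 'n \<Rightarrow> 'n \<Rightarrow> 'n) \<Rightarrow> ('x \<Rightarrow> 'n) \<Rightarrow> bool" where
  "free_nc_multi_novikov _ scale tri i \<longleftrightarrow>
     nc_multi_novikov scale tri \<and>
     (\<forall>(scale' :: 'k \<Rightarrow> 'm \<Rightarrow> 'm) tri' (g :: 'x \<Rightarrow> 'm).
        nc_multi_novikov scale' tri' \<longrightarrow>
        (\<exists>!h. nmn_hom scale tri scale' tri' h \<and> (\<forall>x. h (i x) = g x)))"

definition two_sided_ideal ::
  "('k::field \<Rightarrow> 'n::ab_group_add \<Rightarrow> 'n) \<Rightarrow> ('o \<Rightarrow> 'n \<Rightarrow> 'n \<Rightarrow> 'n) \<Rightarrow> 'n set \<Rightarrow> bool" where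
  "two_sided_ideal scale tri I \<longleftrightarrow>
     module.subspace scale I \<and> (\<forall>w a. \<forall>b\<in>I. tri w a b \<in> I \<and> tri w b a \<in> I)"

definition subalgebra ::
  "('k::field \<Rightarrow> 'n::ab_group_add \<Rightarrow> 'n) \<Rightarrow> ('o \<Rightarrow> 'n \<Rightarrow> 'n \<Rightarrow> 'n) \<Rightarrow> 'n set \<Rightarrow> bool" where
  "subalgebra scale tri S \<longleftrightarrow>
     module.subspace scale S \<and> (\<forall>w. \<forall>a\<in>S. \<forall>b\<in>S. tri w a b \<in> S)"


section \<open>Vector spaces with a given basis\<close>

text \<open>The space with basis \<open>'a\<close> is the type of finitely supported functions \<open>'a \<Rightarrow>\<^sub>0 'k\<close>.\<close>

definition kscale :: "'k::field \<Rightarrow> ('a \<Rightarrow>\<^sub>0 'k) \<Rightarrow> ('a \<Rightarrow>\<^sub>0 'k)" where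
  "kscale c p = Poly_Mapping.map ((*) c) p"

abbreviation basis_elem :: "'a \<Rightarrow> ('a \<Rightarrow>\<^sub>0 'k::field)" where
  "basis_elem a \<equiv> Poly_Mapping.single a 1"

definition lin_ext :: "('a \<Rightarrow> ('b \<Rightarrow>\<^sub>0 'k::field)) \<Rightarrow> ('a \<Rightarrow>\<^sub>0 'k) \<Rightarrow> ('b \<Rightarrow>\<^sub>0 'k)" where
  "lin_ext g p = (\<Sum>a\<in>Poly_Mapping.keys p. kscale (Poly_Mapping.lookup p a) (g a))"

lemma lookup_kscale [simp]:
  "Poly_Mapping.lookup (kscale c p) a = c * Poly_Mapping.lookup p a"
  by (simp add: kscale_def map.rep_eq when_def)

lemma vector_space_kscale: "vector_space (kscale :: 'k::field \<Rightarrow> ('a \<Rightarrow>\<^sub>0 'k) \<Rightarrow> _)"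
  by unfold_locales (rule poly_mapping_eqI; simp add: lookup_add algebra_simps)+

interpretation kspace: vector_space "kscale :: 'k::field \<Rightarrow> ('a \<Rightarrow>\<^sub>0 'k) \<Rightarrow> ('a \<Rightarrow>\<^sub>0 'k)"
  by (rule vector_space_kscale)

lemma lin_ext_superset:
  assumes "finite A" "Poly_Mapping.keys p \<subseteq> A"
  shows "lin_ext g p = (\<Sum>a\<in>A. kscale (Poly_Mapping.lookup p a) (g a))"
  unfolding lin_ext_def
  by (rule sum.mono_neutral_left) (use assms in \<open>auto simp: in_keys_iff\<close>)

lemma lin_ext_add: "lin_ext g (p + q) = lin_ext g p + lin_ext g q"
proof -
  let ?A = "Poly_Mapping.keys p \<union> Poly_Mapping.keys q"
  have "lin_ext g (p + q) = (\<Sum>a\<in>?A. kscale (Poly_Mapping.lookup (p + q) a) (g a))"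
    by (rule lin_ext_superset) (use Poly_Mapping.keys_add[of p q] in auto)
  also have "\<dots> = lin_ext g p + lin_ext g q"
    by (simp add: lin_ext_superset[of ?A] lookup_add kspace.scale_left_distrib sum.distrib)
  finally show ?thesis .
qed

lemma lin_ext_scale: "lin_ext g (kscale c p) = kscale c (lin_ext g p)"
proof -
  have "lin_ext g (kscale c p) =
      (\<Sum>a\<in>Poly_Mapping.keys p. kscale (Poly_Mapping.lookup (kscale c p) a) (g a))"
    by (rule lin_ext_superset) (auto simp: in_keys_iff)
  then show ?thesis by (simp add: lin_ext_def kspace.scale_sum_right)
qed

lemma linear_lin_ext: "Vector_Spaces.linear kscale kscale (lin_ext g)"
  by unfold_locales (simp_all add: lin_ext_add lin_ext_scale)

lemma lin_ext_basis_elem [simp]: "lin_ext g (basis_elem a) = g a"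
  by (simp add: lin_ext_def)

lemma lin_ext_fun_add: "lin_ext (\<lambda>a. g a + h a) p = lin_ext g p + lin_ext h p"
  by (simp add: lin_ext_def kspace.scale_right_distrib sum.distrib)

lemma lin_ext_fun_scale: "lin_ext (\<lambda>a. kscale c (g a)) p = kscale c (lin_ext g p)"
  by (simp add: lin_ext_def kspace.scale_sum_right mult.commute)


section \<open>Typed decorated rooted trees\<close>

text \<open>
  \<open>r(y\<^sub>1, \<omega>\<^sub>1, \<dots>, y\<^sub>n, \<omega>\<^sub>n; z)\<close> is \<open>R [(y\<^sub>1, \<omega>\<^sub>1), \<dots>, (y\<^sub>n, \<omega>\<^sub>n)] z\<close>. The sets \<open>X\<close> and \<open>\<Omega>\<close> are the
  types \<open>'x\<close> and \<open>'o\<close>.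
\<close>

datatype ('x, 'o) mtree = R (branches: "(('x, 'o) mtree \<times> 'o) list") (root: 'x)

abbreviation vertex :: "'x \<Rightarrow> ('x, 'o) mtree" where
  "vertex z \<equiv> R [] z"

fun graft :: "'o \<Rightarrow> ('x, 'o) mtree \<Rightarrow> ('x, 'o) mtree \<Rightarrow> ('x, 'o) mtree" where
  "graft w u (R bs z) = R ((u, w) # bs) z"

definition tree_tri ::
  "'o \<Rightarrow> (('x, 'o) mtree \<Rightarrow>\<^sub>0 'k::field) \<Rightarrow> (('x, 'o) mtree \<Rightarrow>\<^sub>0 'k) \<Rightarrow> (('x, 'o) mtree \<Rightarrow>\<^sub>0 'k)"
  where
  "tree_tri w p q = lin_ext (\<lambda>u. lin_ext (\<lambda>v. basis_elem (graft w u v)) q) p"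

definition novikov_relators :: "(('x, 'o) mtree \<Rightarrow>\<^sub>0 'k::field) set" where
  "novikov_relators =
     {tree_tri t (tree_tri w x y) z - tree_tri w x (tree_tri t y z)
        - tree_tri t (tree_tri w y x) z + tree_tri w y (tree_tri t x z) | w t x y z. True} \<union>
     {tree_tri t (tree_tri w x y) z - tree_tri w (tree_tri t x z) y | w t x y z. True}"

definition J :: "(('x, 'o) mtree \<Rightarrow>\<^sub>0 'k::field) set" where
  "J = two_sided_ideal kscale tree_tri hull novikov_relators"

lemma linear_tree_tri_left: "Vector_Spaces.linear kscale kscale (\<lambda>p. tree_tri w p q)"
  unfolding tree_tri_def by (rule linear_lin_ext)

lemma linear_tree_tri_right: "Vector_Spaces.linear kscale kscale (\<lambda>q. tree_tri w p q)"
  by unfold_locales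
    (simp_all add: tree_tri_def lin_ext_add lin_ext_scale lin_ext_fun_add lin_ext_fun_scale)

lemma tree_tri_basis_elem [simp]:
  "tree_tri w (basis_elem u) (basis_elem v) = basis_elem (graft w u v)"
  by (simp add: tree_tri_def)

lemma two_sided_ideal_J:
  "two_sided_ideal kscale tree_tri (J :: (('a, 'b) mtree \<Rightarrow>\<^sub>0 'c::field) set)"
  unfolding J_def
proof (rule hull_in)
  fix T :: "(('a, 'b) mtree \<Rightarrow>\<^sub>0 'c) set set"
  assume T: "Ball T (two_sided_ideal kscale tree_tri)"
  then have "kspace.subspace (\<Inter>T)"
    by (intro kspace.subspace_Inter) (simp add: two_sided_ideal_def)
  with T show "two_sided_ideal kscale tree_tri (\<Inter>T)"
    by (simp add: two_sided_ideal_def)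
qed

lemma subspace_J: "kspace.subspace J"
  by (rule two_sided_ideal_J[unfolded two_sided_ideal_def, THEN conjunct1])

lemma J_tri:
  "p \<in> J \<Longrightarrow> tree_tri w q p \<in> J"
  "p \<in> J \<Longrightarrow> tree_tri w p q \<in> J"
  by (simp_all add: two_sided_ideal_J[unfolded two_sided_ideal_def, THEN conjunct2, rule_format])


section \<open>The quotient by \<open>J\<close>\<close>

definition cong_J :: "(('x, 'o) mtree \<Rightarrow>\<^sub>0 'k::field) \<Rightarrow> (('x, 'o) mtree \<Rightarrow>\<^sub>0 'k) \<Rightarrow> bool" where
  "cong_J p q \<longleftrightarrow> p - q \<in> J"

lemma cong_J_refl: "cong_J p p"
  by (simp add: cong_J_def kspace.subspace_0[OF subspace_J])

lemma cong_J_sym: "cong_J p q \<Longrightarrow> cong_J q p"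
  unfolding cong_J_def by (drule kspace.subspace_neg[OF subspace_J]) simp

lemma cong_J_trans: "cong_J p q \<Longrightarrow> cong_J q r \<Longrightarrow> cong_J p r"
  unfolding cong_J_def by (drule (1) kspace.subspace_add[OF subspace_J]) simp

lemma equivp_cong_J: "equivp cong_J"
  by (intro equivpI reflpI sympI transpI) (fact cong_J_refl cong_J_sym cong_J_trans)+

lifting_forget poly_mapping.lifting

quotient_type (overloaded) ('x, 'o, 'k) nov = "('x, 'o) mtree \<Rightarrow>\<^sub>0 'k::field" / cong_J
  by (rule equivp_cong_J)

lift_definition coset :: "(('x, 'o) mtree \<Rightarrow>\<^sub>0 'k::field) \<Rightarrow> ('x, 'o, 'k) nov" is "\<lambda>p. p" .

instantiation nov :: (type, type, field) ab_group_add
begin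

lift_definition zero_nov :: "('a, 'b, 'c) nov" is 0 .

lift_definition plus_nov :: "('a, 'b, 'c) nov \<Rightarrow> ('a, 'b, 'c) nov \<Rightarrow> ('a, 'b, 'c) nov" is "(+)"
  by (simp add: cong_J_def add_diff_add kspace.subspace_add[OF subspace_J])

lift_definition uminus_nov :: "('a, 'b, 'c) nov \<Rightarrow> ('a, 'b, 'c) nov" is uminus
  unfolding cong_J_def by (drule kspace.subspace_neg[OF subspace_J]) simp

lift_definition minus_nov :: "('a, 'b, 'c) nov \<Rightarrow> ('a, 'b, 'c) nov \<Rightarrow> ('a, 'b, 'c) nov" is "(-)"
  unfolding cong_J_def
  by (drule (1) kspace.subspace_diff[OF subspace_J]) (simp add: algebra_simps)

instance
proof
  fix a b c :: "('a, 'b, 'c) nov"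
  show "a + b + c = a + (b + c)"
    by transfer (simp add: add.assoc cong_J_refl)
  show "a + b = b + a"
    by transfer (simp add: add.commute cong_J_refl)
  show "0 + a = a"
    by transfer (simp add: cong_J_refl)
  show "- a + a = 0"
    by transfer (simp add: cong_J_refl)
  show "a - b = a + - b"
    by transfer (simp add: cong_J_refl)
qed

end

lift_definition nov_scale :: "'k::field \<Rightarrow> ('x, 'o, 'k) nov \<Rightarrow> ('x, 'o, 'k) nov" is kscale
  unfolding cong_J_def
  by (metis kspace.scale_right_diff_distrib kspace.subspace_scale[OF subspace_J])

lift_definition nov_tri ::
  "'o \<Rightarrow> ('x, 'o, 'k::field) nov \<Rightarrow> ('x, 'o, 'k) nov \<Rightarrow> ('x, 'o, 'k) nov" is tree_tri
proof -
  fix w :: 'o and p p' q q' :: "('x, 'o) mtree \<Rightarrow>\<^sub>0 'k"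
  assume "cong_J p p'" "cong_J q q'"
  then have "tree_tri w (p - p') q + tree_tri w p' (q - q') \<in> J"
    by (simp add: cong_J_def J_tri kspace.subspace_add[OF subspace_J])
  also have "tree_tri w (p - p') q + tree_tri w p' (q - q') = tree_tri w p q - tree_tri w p' q'"
    using module_hom.diff[OF linear_tree_tri_left[unfolded linear_iff_module_hom], of w p p' q]
      module_hom.diff[OF linear_tree_tri_right[unfolded linear_iff_module_hom], of w p' q q']
    by simp
  finally show "cong_J (tree_tri w p q) (tree_tri w p' q')"
    by (simp add: cong_J_def)
qed


section \<open>Noncommuting multi-Novikov elements\<close>

inductive nest :: "('x, 'o) mtree \<Rightarrow> bool" where
  "nest (vertex z)"
| "nest y1 \<Longrightarrow> (\<And>y w. (y, w) \<in> set bs \<Longrightarrow> \<exists>x. y = vertex x) \<Longrightarrow> nest (R ((y1, w1) # bs) z)"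

text \<open>
  The comparison of a nest with its first branch is imposed at every level, i.e. the first
  branch has to be ordered as well. If only the root level were compared, then for \<open>z\<^sub>1 < z\<^sub>2\<close>
  both \<open>r(r(r(x,\<omega>;z\<^sub>1),\<omega>;z\<^sub>2),\<omega>;z\<^sub>1)\<close> and \<open>r(r(r(x,\<omega>;z\<^sub>2),\<omega>;z\<^sub>1),\<omega>;z\<^sub>1)\<close> would be ordered, although
  right commutativity identifies them modulo \<open>J\<close>.
\<close>

inductive ordered_nest :: "('x::linorder, 'o::linorder) mtree \<Rightarrow> bool" where
  single: "ordered_nest (vertex z)"
| leaf: "nest u \<Longrightarrow> u = R ((y1, w1) # bs) z \<Longrightarrow> y1 = vertex x \<Longrightarrow> ordered_nest u"
| longer: "nest u \<Longrightarrow> u = R ((y1, w1) # bs) z \<Longrightarrow> y1 = R cs z' \<Longrightarrow> ordered_nest y1 \<Longrightarrow>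
    length cs > length (branches u) \<Longrightarrow> ordered_nest u"
| root: "nest u \<Longrightarrow> u = R ((y1, w1) # bs) z \<Longrightarrow> y1 = R cs z' \<Longrightarrow> ordered_nest y1 \<Longrightarrow>
    length cs = length (branches u) \<Longrightarrow> z' > z \<Longrightarrow> ordered_nest u"
| lex: "nest u \<Longrightarrow> u = R ((y1, w1) # bs) z \<Longrightarrow> y1 = R cs z' \<Longrightarrow> ordered_nest y1 \<Longrightarrow>
    length cs = length (branches u) \<Longrightarrow> z' = z \<Longrightarrow>
    lexordp_eq (map snd (branches u)) (map snd cs) \<Longrightarrow> ordered_nest u"

fun leaf_seq :: "('x, 'o) mtree \<Rightarrow> 'x list" where
  "leaf_seq (R [] z) = [z]"
| "leaf_seq (R ((y1, w1) # bs) z) = leaf_seq y1 @ map (\<lambda>(y, w). root y) bs"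

definition MNE :: "('x::linorder, 'o::linorder) mtree set" where
  "MNE = {u. ordered_nest u \<and> sorted (rev (leaf_seq u))}"

definition kMNE :: "(('x::linorder, 'o::linorder) mtree \<Rightarrow>\<^sub>0 'k::field) set" where
  "kMNE = module.span kscale (basis_elem ` MNE)"


section \<open>Differential polynomials\<close>

text \<open>
  The variable \<open>(\<partial>\<^sub>\<omega>\<^sub>1 \<dots> \<partial>\<^sub>\<omega>\<^sub>k)(x)\<close> is the pair of the list of the \<open>\<omega>\<^sub>i\<close> and \<open>x\<close>, a monomial is a finitely
  supported exponent function, and multiplication of polynomials is the convolution product
  of \<open>_ \<Rightarrow>\<^sub>0 _\<close>.
\<close>

type_synonym ('x, 'o, 'k) dpoly = "(('o list \<times> 'x) \<Rightarrow>\<^sub>0 nat) \<Rightarrow>\<^sub>0 'k"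

definition dvar :: "'o list \<Rightarrow> 'x \<Rightarrow> ('x, 'o, 'k::field) dpoly" where
  "dvar ws x = basis_elem (Poly_Mapping.single (ws, x) 1)"

definition deriv_monom :: "'o \<Rightarrow> (('o list \<times> 'x) \<Rightarrow>\<^sub>0 nat) \<Rightarrow> ('x, 'o, 'k::field) dpoly" where
  "deriv_monom w m =
     (\<Sum>(ws, x)\<in>Poly_Mapping.keys m.
        of_nat (Poly_Mapping.lookup m (ws, x)) *
          basis_elem (m - Poly_Mapping.single (ws, x) 1) * dvar (w # ws) x)"

definition D :: "'o \<Rightarrow> ('x, 'o, 'k::field) dpoly \<Rightarrow> ('x, 'o, 'k) dpoly" where
  "D w = lin_ext (deriv_monom w)"

definition dpoly_tri ::
  "'o \<Rightarrow> ('x, 'o, 'k::field) dpoly \<Rightarrow> ('x, 'o, 'k) dpoly \<Rightarrow> ('x, 'o, 'k) dpoly" where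
  "dpoly_tri w u v = u * D w v"

lemma linear_D: "Vector_Spaces.linear kscale kscale (D w)"
  unfolding D_def by (rule linear_lin_ext)

lemma D_dvar: "D w (dvar ws x) = dvar (w # ws) x"
  by (simp add: D_def dvar_def deriv_monom_def)

lemma deriv_monom_superset:
  assumes "finite A" "Poly_Mapping.keys m \<subseteq> A"
  shows "deriv_monom w m =
     (\<Sum>(ws, x)\<in>A. of_nat (Poly_Mapping.lookup m (ws, x)) *
          basis_elem (m - Poly_Mapping.single (ws, x) 1) * dvar (w # ws) x)"
  unfolding deriv_monom_def
  by (rule sum.mono_neutral_left) (use assms in \<open>auto simp: in_keys_iff\<close>)

lemma deriv_monom_add:
  "(deriv_monom w (m + n) :: ('x, 'o, 'k::field) dpoly) =
     basis_elem m * deriv_monom w n + basis_elem n * deriv_monom w m"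
proof -
  let ?A = "Poly_Mapping.keys m \<union> Poly_Mapping.keys n"
  let ?s = "\<lambda>v. Poly_Mapping.single v (1::nat)"
  let ?b = "basis_elem :: _ \<Rightarrow> ('x, 'o, 'k) dpoly"
  have shift: "of_nat (Poly_Mapping.lookup k v) * ?b (l + k - ?s v) =
      ?b l * (of_nat (Poly_Mapping.lookup k v) * ?b (k - ?s v))" for k l v
  proof (cases "Poly_Mapping.lookup k v = 0")
    case False
    have "l + k - ?s v = l + (k - ?s v)"
      by (rule poly_mapping_eqI) (use False in \<open>auto simp: lookup_add lookup_minus lookup_single when_def\<close>)
    moreover have "?b (l + (k - ?s v)) = ?b l * ?b (k - ?s v)"
      by (simp add: mult_single)
    ultimately show ?thesis
      by (simp only: mult.left_commute)
  qed simp
  have summand: "of_nat (Poly_Mapping.lookup (m + n) v) * ?b (m + n - ?s v) * d =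
      ?b m * (of_nat (Poly_Mapping.lookup n v) * ?b (n - ?s v) * d) +
      ?b n * (of_nat (Poly_Mapping.lookup m v) * ?b (m - ?s v) * d)" for v d
  proof -
    have "of_nat (Poly_Mapping.lookup (m + n) v) * ?b (m + n - ?s v) =
        of_nat (Poly_Mapping.lookup n v) * ?b (m + n - ?s v) +
        of_nat (Poly_Mapping.lookup m v) * ?b (n + m - ?s v)"
      by (simp only: lookup_add of_nat_add distrib_right add.commute)
    then show ?thesis
      by (simp only: shift distrib_right mult.assoc)
  qed
  have "Poly_Mapping.keys (m + n) \<subseteq> ?A" by (rule Poly_Mapping.keys_add)
  then show ?thesis
    by (simp add: deriv_monom_superset[of ?A] summand case_prod_unfold sum.distrib sum_distrib_left
        del: One_nat_def)
qed

lemma kscale_single: "kscale c (Poly_Mapping.single a d) = Poly_Mapping.single a (c * d)"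
  by (rule poly_mapping_eqI) (simp add: lookup_single when_def)

lemma poly_mapping_sum_singles:
  "(\<Sum>a\<in>Poly_Mapping.keys p. Poly_Mapping.single a (Poly_Mapping.lookup p a)) = p"
  by (rule poly_mapping_eqI)
    (simp add: lookup_sum lookup_single when_def sum.delta in_keys_iff)

lemma kspace_induct [case_names basis scale add]:
  fixes p :: "'a \<Rightarrow>\<^sub>0 'k::field"
  assumes "\<And>a. P (basis_elem a)" "\<And>c p. P p \<Longrightarrow> P (kscale c p)" "\<And>p q. P p \<Longrightarrow> P q \<Longrightarrow> P (p + q)"
  shows "P p"
proof -
  have single: "P (Poly_Mapping.single a c)" for a c
    using assms(2)[OF assms(1), of c a] by (simp add: kscale_single)
  then have "P 0"
    by (metis single_zero)
  then have "P (\<Sum>a\<in>A. Poly_Mapping.single a (Poly_Mapping.lookup p a))" for A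
    by (induction A rule: infinite_finite_induct) (simp_all add: assms(3) single)
  then show ?thesis
    using poly_mapping_sum_singles[of p] by metis
qed

lemma kscale_eq_mult: "kscale c p = Poly_Mapping.single 0 c * p"
  for p :: "'a::monoid_add \<Rightarrow>\<^sub>0 'k::field"
proof -
  have "Poly_Mapping.single 0 c * p =
      Poly_Mapping.single 0 c *
        (\<Sum>a\<in>Poly_Mapping.keys p. Poly_Mapping.single a (Poly_Mapping.lookup p a))"
    by (simp add: poly_mapping_sum_singles)
  also have "\<dots> = (\<Sum>a\<in>Poly_Mapping.keys p. kscale c (Poly_Mapping.single a (Poly_Mapping.lookup p a)))"
    by (simp add: sum_distrib_left mult_single kscale_single)
  also have "\<dots> = kscale c p"
    by (simp add: kspace.scale_sum_right[symmetric] poly_mapping_sum_singles)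
  finally show ?thesis by simp
qed

lemma kscale_mult_left: "kscale c p * q = kscale c (p * q)"
  for p q :: "'a::monoid_add \<Rightarrow>\<^sub>0 'k::field"
  by (simp add: kscale_eq_mult mult.assoc)

lemma kscale_mult_right: "p * kscale c q = kscale c (p * q)"
  for p q :: "'a::comm_monoid_add \<Rightarrow>\<^sub>0 'k::field"
  by (simp add: kscale_eq_mult mult.left_commute)

lemma D_mult: "D w (p * q) = D w p * q + p * D w q"
proof (induction p rule: kspace_induct)
  case (basis m)
  show ?case
  proof (induction q rule: kspace_induct)
    case (basis n)
    show ?case
      by (simp add: mult_single D_def deriv_monom_add mult.commute add.commute)
  next
    case (scale c q)
    then show ?case
      by (simp add: kscale_mult_right D_def lin_ext_scale kspace.scale_right_distrib)
  next
    case (add q q')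
    then show ?case by (simp add: distrib_left D_def lin_ext_add)
  qed
next
  case (scale c p)
  then show ?case
    by (simp add: kscale_mult_left D_def lin_ext_scale kspace.scale_right_distrib)
next
  case (add p p')
  then show ?case by (simp add: distrib_right D_def lin_ext_add)
qed

definition PCD_set :: "('x, 'o, 'k::field) dpoly set" where
  "PCD_set = subalgebra kscale dpoly_tri hull range (dvar [])"

lemma subalgebra_PCD_set:
  "subalgebra kscale dpoly_tri (PCD_set :: ('a, 'b, 'c::field) dpoly set)"
  unfolding PCD_set_def
proof (rule hull_in)
  fix T :: "('a, 'b, 'c) dpoly set set"
  assume T: "Ball T (subalgebra kscale dpoly_tri)"
  then have "kspace.subspace (\<Inter>T)"
    by (intro kspace.subspace_Inter) (simp add: subalgebra_def)
  with T show "subalgebra kscale dpoly_tri (\<Inter>T)"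
    by (simp add: subalgebra_def)
qed

lemma subspace_PCD_set: "kspace.subspace PCD_set"
  by (rule subalgebra_PCD_set[unfolded subalgebra_def, THEN conjunct1])

typedef (overloaded) ('x, 'o, 'k::field) pcd = "PCD_set :: ('x, 'o, 'k) dpoly set"
  by (rule exI[of _ 0]) (rule kspace.subspace_0[OF subspace_PCD_set])

setup_lifting type_definition_pcd

instantiation pcd :: (type, type, field) ab_group_add
begin

lift_definition zero_pcd :: "('a, 'b, 'c) pcd" is 0
  by (rule kspace.subspace_0[OF subspace_PCD_set])

lift_definition plus_pcd :: "('a, 'b, 'c) pcd \<Rightarrow> ('a, 'b, 'c) pcd \<Rightarrow> ('a, 'b, 'c) pcd" is "(+)"
  by (rule kspace.subspace_add[OF subspace_PCD_set])

lift_definition uminus_pcd :: "('a, 'b, 'c) pcd \<Rightarrow> ('a, 'b, 'c) pcd" is uminus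
  by (rule kspace.subspace_neg[OF subspace_PCD_set])

lift_definition minus_pcd :: "('a, 'b, 'c) pcd \<Rightarrow> ('a, 'b, 'c) pcd \<Rightarrow> ('a, 'b, 'c) pcd" is "(-)"
  by (rule kspace.subspace_diff[OF subspace_PCD_set])

instance
proof
  fix a b c :: "('a, 'b, 'c) pcd"
  show "a + b + c = a + (b + c)"
    by transfer (rule add.assoc)
  show "a + b = b + a"
    by transfer (rule add.commute)
  show "0 + a = a"
    by transfer simp
  show "- a + a = 0"
    by transfer simp
  show "a - b = a + - b"
    by transfer simp
qed

end

lift_definition pcd_scale :: "'k::field \<Rightarrow> ('x, 'o, 'k) pcd \<Rightarrow> ('x, 'o, 'k) pcd" is kscale
  by (rule kspace.subspace_scale[OF subspace_PCD_set])

lift_definition pcd_tri ::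
  "'o \<Rightarrow> ('x, 'o, 'k::field) pcd \<Rightarrow> ('x, 'o, 'k) pcd \<Rightarrow> ('x, 'o, 'k) pcd" is dpoly_tri
  by (rule subalgebra_PCD_set[unfolded subalgebra_def, THEN conjunct2, rule_format])

lift_definition pcd_var :: "'x \<Rightarrow> ('x, 'o, 'k::field) pcd" is "dvar []"
  unfolding PCD_set_def by (rule hull_inc) (rule rangeI)

end

theory Submission
  imports Defs "HOL-Library.Multiset" "HOL-Library.Product_Lexorder" "HOL-Library.List_Lexorder"
begin

text \<open>
  Spanning. In a noncommuting multi-Novikov algebra all right multiplications commute, so the
  levels of a nest can be permuted freely; in particular every level can be made the innermost one.
  Left symmetry then exchanges the innermost leaf with any leaf of that level, modulo nests with
  fewer leaves, and such exchanges generate all permutations of the leaves. By induction on the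
  number of leaves every nest is a combination of noncommuting multi-Novikov elements. The span of
  the nests is closed under the products because two levels can be taken off the right factor:
  \<open>u \<rhd>\<^sub>\<omega> ((v \<rhd>\<^sub>\<tau> y) \<rhd>\<^sub>\<sigma> z) = (v \<rhd>\<^sub>\<omega> (u \<rhd>\<^sub>\<tau> y)) \<rhd>\<^sub>\<sigma> z + (u \<rhd>\<^sub>\<omega> (v \<rhd>\<^sub>\<sigma> z)) \<rhd>\<^sub>\<tau> y - ((v \<rhd>\<^sub>\<sigma> z) \<rhd>\<^sub>\<omega> u) \<rhd>\<^sub>\<tau> y\<close>.

  Independence. In differential polynomials a nest evaluates to the product of its leaves and of
  the variables \<open>(\<partial>\<^sub>\<omega>\<^sub>1 \<dots> \<partial>\<^sub>\<omega>\<^sub>n)(z)\<close> of its levels, plus monomials with fewer underived variables.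
  Distinct noncommuting multi-Novikov elements have distinct leading monomials.
\<close>

section \<open>Vector spaces with a given basis\<close>

lemma span_basis_elem:
  "kspace.span (basis_elem ` A) = {p :: 'a \<Rightarrow>\<^sub>0 'k::field. Poly_Mapping.keys p \<subseteq> A}"
proof
  show "kspace.span (basis_elem ` A) \<subseteq> {p :: 'a \<Rightarrow>\<^sub>0 'k. Poly_Mapping.keys p \<subseteq> A}"
  proof (rule kspace.span_minimal)
    show "kspace.subspace {p :: 'a \<Rightarrow>\<^sub>0 'k. Poly_Mapping.keys p \<subseteq> A}"
    proof (rule kspace.subspaceI)
      fix p q :: "'a \<Rightarrow>\<^sub>0 'k" and c
      assume p_keys: "p \<in> {p. Poly_Mapping.keys p \<subseteq> A}"
      then show "kscale c p \<in> {p. Poly_Mapping.keys p \<subseteq> A}"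
        by (auto simp: in_keys_iff)
      assume "q \<in> {p. Poly_Mapping.keys p \<subseteq> A}"
      with p_keys show "p + q \<in> {p. Poly_Mapping.keys p \<subseteq> A}"
        using Poly_Mapping.keys_add[of p q] by auto
    qed simp
  qed auto
  show "{p :: 'a \<Rightarrow>\<^sub>0 'k. Poly_Mapping.keys p \<subseteq> A} \<subseteq> kspace.span (basis_elem ` A)"
  proof safe
    fix p :: "'a \<Rightarrow>\<^sub>0 'k"
    assume "Poly_Mapping.keys p \<subseteq> A"
    then have "(\<Sum>a\<in>Poly_Mapping.keys p. kscale (Poly_Mapping.lookup p a) (basis_elem a))
        \<in> kspace.span (basis_elem ` A)"
      by (intro kspace.span_sum kspace.span_scale kspace.span_base) auto
    then show "p \<in> kspace.span (basis_elem ` A)"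
      by (simp add: kscale_single poly_mapping_sum_singles)
  qed
qed

lemma independent_basis_elem: "kspace.independent (basis_elem ` A :: ('a \<Rightarrow>\<^sub>0 'k::field) set)"
proof
  assume "kspace.dependent (basis_elem ` A :: ('a \<Rightarrow>\<^sub>0 'k) set)"
  then obtain a where "basis_elem a \<in> kspace.span (basis_elem ` A - {basis_elem a :: 'a \<Rightarrow>\<^sub>0 'k})"
    by (auto simp: kspace.dependent_def)
  moreover have "basis_elem ` A - {basis_elem a :: 'a \<Rightarrow>\<^sub>0 'k} \<subseteq> basis_elem ` (A - {a})"
    by auto
  ultimately have "(basis_elem a :: 'a \<Rightarrow>\<^sub>0 'k) \<in> kspace.span (basis_elem ` (A - {a}))"
    using kspace.span_mono by blast
  then show False
    by (simp add: span_basis_elem)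
qed

lemma inj_on_lin_ext_if_distinct_leading:
  fixes h :: "'a \<Rightarrow> ('b \<Rightarrow>\<^sub>0 'k::field)" and lead :: "'a \<Rightarrow> 'b" and deg :: "'b \<Rightarrow> 'd::linorder"
  assumes inj: "inj_on lead A"
    and lead: "\<And>a. a \<in> A \<Longrightarrow> lead a \<in> Poly_Mapping.keys (h a)"
    and below: "\<And>a b. a \<in> A \<Longrightarrow> b \<in> Poly_Mapping.keys (h a) \<Longrightarrow> b \<noteq> lead a \<Longrightarrow> deg b < deg (lead a)"
  shows "inj_on (lin_ext h) (kspace.span (basis_elem ` A))"
proof -
  interpret Vector_Spaces.linear kscale kscale "lin_ext h" by (rule linear_lin_ext)
  have "p = 0" if "p \<in> kspace.span (basis_elem ` A)" "lin_ext h p = 0" for p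
  proof (rule ccontr)
    assume "p \<noteq> 0"
    have keys: "Poly_Mapping.keys p \<subseteq> A"
      using that(1) by (simp add: span_basis_elem)
    obtain a where Max: "(MAX b\<in>Poly_Mapping.keys p. deg (lead b)) = deg (lead a)"
      and a_key: "a \<in> Poly_Mapping.keys p"
      using \<open>p \<noteq> 0\<close> by (metis finite_keys keys_eq_empty obtains_MAX)
    have max: "deg (lead b) \<le> deg (lead a)" if "b \<in> Poly_Mapping.keys p" for b
      unfolding Max[symmetric] using that by simp
    have "Poly_Mapping.lookup (h b) (lead a) = 0" if "b \<in> Poly_Mapping.keys p" "b \<noteq> a" for b
    proof (rule ccontr)
      have "lead a \<noteq> lead b"
        using inj keys a_key that by (metis inj_onD subsetD)
      moreover assume "Poly_Mapping.lookup (h b) (lead a) \<noteq> 0"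
      ultimately have "deg (lead a) < deg (lead b)"
        using below[of b "lead a"] keys that(1) by (auto simp: in_keys_iff)
      then show False
        using max[OF that(1)] by simp
    qed
    then have "Poly_Mapping.lookup (lin_ext h p) (lead a) =
        (\<Sum>b\<in>Poly_Mapping.keys p.
           if b = a then Poly_Mapping.lookup p a * Poly_Mapping.lookup (h a) (lead a) else 0)"
      unfolding lin_ext_def lookup_sum lookup_kscale by (intro sum.cong) auto
    also have "\<dots> \<noteq> 0"
      using a_key keys lead[of a] by (auto simp: in_keys_iff)
    finally show False
      using that(2) by simp
  qed
  then show ?thesis
    by (simp add: inj_on_iff_eq_0)
qed

definition lin_ext_to :: "('k::field \<Rightarrow> 'm::ab_group_add \<Rightarrow> 'm) \<Rightarrow> ('a \<Rightarrow> 'm) \<Rightarrow> ('a \<Rightarrow>\<^sub>0 'k) \<Rightarrow> 'm"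
  where
  "lin_ext_to scale h p = (\<Sum>a\<in>Poly_Mapping.keys p. scale (Poly_Mapping.lookup p a) (h a))"

lemma lin_ext_to_kscale: "lin_ext_to kscale = lin_ext"
  by (simp add: fun_eq_iff lin_ext_to_def lin_ext_def)

context vector_space
begin

lemma lin_ext_to_superset:
  assumes "finite A" "Poly_Mapping.keys p \<subseteq> A"
  shows "lin_ext_to scale h p = (\<Sum>a\<in>A. scale (Poly_Mapping.lookup p a) (h a))"
  unfolding lin_ext_to_def
  by (rule sum.mono_neutral_left) (use assms in \<open>auto simp: in_keys_iff\<close>)

lemma linear_lin_ext_to: "Vector_Spaces.linear kscale scale (lin_ext_to scale h)"
proof -
  have "lin_ext_to scale h (p + q) = lin_ext_to scale h p + lin_ext_to scale h q" for p q
    by (simp add: lin_ext_to_superset[of "Poly_Mapping.keys p \<union> Poly_Mapping.keys q"]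
        Poly_Mapping.keys_add lookup_add scale_left_distrib sum.distrib)
  moreover have "lin_ext_to scale h (kscale c p) = scale c (lin_ext_to scale h p)" for c p
  proof -
    have "Poly_Mapping.keys (kscale c p) \<subseteq> Poly_Mapping.keys p"
      by (auto simp: in_keys_iff)
    then show ?thesis
      by (simp add: lin_ext_to_superset[of "Poly_Mapping.keys p"] scale_sum_right)
  qed
  ultimately show ?thesis
    by (simp add: Vector_Spaces.linear_iff vector_space_axioms vector_space_kscale)
qed

lemma linear_eq_lin_ext_to:
  assumes "Vector_Spaces.linear kscale scale H"
  shows "H p = lin_ext_to scale (\<lambda>a. H (basis_elem a)) p"
proof -
  interpret lin: Vector_Spaces.linear kscale scale H by (rule assms)
  have "H p = H (\<Sum>a\<in>Poly_Mapping.keys p. kscale (Poly_Mapping.lookup p a) (basis_elem a))"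
    by (simp add: kscale_single poly_mapping_sum_singles)
  then show ?thesis
    by (simp add: lin.sum lin.scale lin_ext_to_def)
qed

end

section \<open>Homomorphisms and freeness\<close>

lemma nmn_hom_comp:
  "nmn_hom scale1 tri1 scale2 tri2 f \<Longrightarrow> nmn_hom scale2 tri2 scale3 tri3 h \<Longrightarrow>
     nmn_hom scale1 tri1 scale3 tri3 (\<lambda>x. h (f x))"
  by (simp add: nmn_hom_def Vector_Spaces.linear_iff)

lemma nmn_hom_inv:
  assumes "nmn_iso scale1 tri1 scale2 tri2 f"
  shows "nmn_hom scale2 tri2 scale1 tri1 (inv f)"
proof -
  have "bij f"
    using assms by (simp add: nmn_iso_def)
  then have inv_eqI: "inv f y = x" if "f x = y" for x y
    using that by (metis bij_inv_eq_iff)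
  have f_inv: "f (inv f y) = y" for y
    using \<open>bij f\<close> by (metis bij_inv_eq_iff)
  have hom: "nmn_hom scale1 tri1 scale2 tri2 f"
    using assms by (simp add: nmn_iso_def)
  have "inv f (x + y) = inv f x + inv f y" "inv f (scale2 c x) = scale1 c (inv f x)"
    "inv f (tri2 w x y) = tri1 w (inv f x) (inv f y)" for x y c w
    by (rule inv_eqI, use hom in \<open>simp add: nmn_hom_def Vector_Spaces.linear_iff f_inv\<close>)+
  then show ?thesis
    using hom by (simp add: nmn_hom_def Vector_Spaces.linear_iff)
qed

lemma subalgebra_range_nmn_hom:
  assumes "nmn_hom scale1 tri1 scale2 tri2 f"
  shows "subalgebra scale2 tri2 (range f)"
proof -
  interpret Vector_Spaces.linear scale1 scale2 f
    using assms by (simp add: nmn_hom_def)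
  have "tri2 w (f x) (f y) \<in> range f" for w x y
    using assms by (metis nmn_hom_def rangeI)
  then show ?thesis
    by (auto simp: subalgebra_def subspace_image)
qed

lemma free_nc_multi_novikov_iso:
  fixes scale1 :: "'k::field \<Rightarrow> 'a::ab_group_add \<Rightarrow> 'a" and tri1 :: "'o \<Rightarrow> 'a \<Rightarrow> 'a \<Rightarrow> 'a"
  assumes free: "free_nc_multi_novikov (target :: 'm::ab_group_add itself) scale1 tri1 i"
    and iso: "nmn_iso scale1 tri1 scale2 tri2 f"
    and "nc_multi_novikov scale2 tri2"
  shows "free_nc_multi_novikov target scale2 tri2 (\<lambda>x. f (i x))"
  unfolding free_nc_multi_novikov_def
proof (intro conjI allI impI \<open>nc_multi_novikov scale2 tri2\<close>)
  fix scale :: "'k \<Rightarrow> 'm \<Rightarrow> 'm" and tri :: "'o \<Rightarrow> 'm \<Rightarrow> 'm \<Rightarrow> 'm" and g :: "_ \<Rightarrow> 'm"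
  assume "nc_multi_novikov scale tri"
  with free have ex1: "\<exists>!h. nmn_hom scale1 tri1 scale tri h \<and> (\<forall>x. h (i x) = g x)"
    unfolding free_nc_multi_novikov_def by blast
  then obtain h where h_hom: "nmn_hom scale1 tri1 scale tri h" and h_eq: "\<And>x. h (i x) = g x"
    by blast
  have hom: "nmn_hom scale1 tri1 scale2 tri2 f" and "bij f"
    using iso by (simp_all add: nmn_iso_def)
  show "\<exists>!h. nmn_hom scale2 tri2 scale tri h \<and> (\<forall>x. h (f (i x)) = g x)"
  proof (rule ex1I)
    show "nmn_hom scale2 tri2 scale tri (\<lambda>y. h (inv f y)) \<and> (\<forall>x. h (inv f (f (i x))) = g x)"
      using nmn_hom_comp[OF nmn_hom_inv[OF iso] h_hom] h_eq \<open>bij f\<close>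
      by (simp add: bij_is_inj)
    fix h' assume h'_extends: "nmn_hom scale2 tri2 scale tri h' \<and> (\<forall>x. h' (f (i x)) = g x)"
    then have "nmn_hom scale1 tri1 scale tri (\<lambda>x. h' (f x))"
      using nmn_hom_comp[OF hom] by blast
    with h'_extends ex1 h_hom h_eq have "(\<lambda>x. h' (f x)) = h" by blast
    then show "h' = (\<lambda>y. h (inv f y))"
      using \<open>bij f\<close> by (auto simp: bij_is_surj surj_f_inv_f)
  qed
qed

section \<open>Evaluation of trees and nests\<close>

fun tree_eval :: "('o \<Rightarrow> 'n \<Rightarrow> 'n \<Rightarrow> 'n) \<Rightarrow> ('x \<Rightarrow> 'n) \<Rightarrow> ('x, 'o) mtree \<Rightarrow> 'n" where
  "tree_eval tri g (R [] z) = g z"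
| "tree_eval tri g (R ((y, w) # bs) z) = tri w (tree_eval tri g y) (tree_eval tri g (R bs z))"

lemma tree_eval_graft:
  "tree_eval tri g (graft w u v) = tri w (tree_eval tri g u) (tree_eval tri g v)"
  by (cases v) simp

lemma mtree_graft_induct [case_names vertex graft]:
  assumes "\<And>z. P (vertex z)" "\<And>w u v. P u \<Longrightarrow> P v \<Longrightarrow> P (graft w u v)"
  shows "P u"
  by (rule tree_eval.induct[of "\<lambda>_ _. P"]) (metis assms graft.simps)+

lemma nmn_hom_tree_eval:
  assumes "nmn_hom scale1 tri1 scale2 tri2 h"
  shows "h (tree_eval tri1 g u) = tree_eval tri2 (\<lambda>x. h (g x)) u"
  using assms by (induction u rule: mtree_graft_induct) (simp_all add: tree_eval_graft nmn_hom_def)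

definition lin_tree_eval ::
    "('k::field \<Rightarrow> 'm::ab_group_add \<Rightarrow> 'm) \<Rightarrow> ('o \<Rightarrow> 'm \<Rightarrow> 'm \<Rightarrow> 'm) \<Rightarrow> ('x \<Rightarrow> 'm) \<Rightarrow>
     (('x, 'o) mtree \<Rightarrow>\<^sub>0 'k) \<Rightarrow> 'm" where
  "lin_tree_eval scale tri g = lin_ext_to scale (tree_eval tri g)"

text \<open>
  A nest is encoded by its innermost leaf \<open>x\<close> and the list of its levels, root first: the vertex
  \<open>r(y\<^sub>1, \<omega>\<^sub>1, \<dots>, y\<^sub>n, \<omega>\<^sub>n; z)\<close> gives the level \<open>(\<omega>\<^sub>1, [(y\<^sub>2, \<omega>\<^sub>2), \<dots>, (y\<^sub>n, \<omega>\<^sub>n)], z)\<close>. The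
  innermost leaf is not counted among the \<open>leaves\<close> of the levels.
\<close>

type_synonym ('x, 'o) level = "'o \<times> ('x \<times> 'o) list \<times> 'x"

fun nest_tree :: "('x, 'o) level list \<Rightarrow> 'x \<Rightarrow> ('x, 'o) mtree" where
  "nest_tree [] x = vertex x"
| "nest_tree ((w, bs, z) # ls) x = R ((nest_tree ls x, w) # map (\<lambda>(y, w). (vertex y, w)) bs) z"

fun leaves :: "('x, 'o) level list \<Rightarrow> 'x list" where
  "leaves [] = []"
| "leaves ((w, bs, z) # ls) = leaves ls @ map fst bs"

fun corolla :: "('o \<Rightarrow> 'n \<Rightarrow> 'n \<Rightarrow> 'n) \<Rightarrow> ('x \<Rightarrow> 'n) \<Rightarrow> ('x \<times> 'o) list \<Rightarrow> 'x \<Rightarrow> 'n" where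
  "corolla tri g [] z = g z"
| "corolla tri g ((y, w) # bs) z = tri w (g y) (corolla tri g bs z)"

fun spine ::
    "('o \<Rightarrow> 'n \<Rightarrow> 'n \<Rightarrow> 'n) \<Rightarrow> ('x \<Rightarrow> 'n) \<Rightarrow> ('x, 'o) level list \<Rightarrow> 'n \<Rightarrow> 'n" where
  "spine tri g [] e = e"
| "spine tri g ((w, bs, z) # ls) e = tri w (spine tri g ls e) (corolla tri g bs z)"

lemma leaf_seq_nest_tree: "leaf_seq (nest_tree ls x) = x # leaves ls"
  by (induction ls) (auto simp: comp_def case_prod_unfold)

lemma mset_leaves: "mset (leaves ls) = (\<Sum>(w, bs, z)\<leftarrow>ls. mset (map fst bs))"
  by (induction ls rule: leaves.induct) auto

lemma mset_leaves_cong: "mset ls = mset ms \<Longrightarrow> mset (leaves ls) = mset (leaves ms)"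
  unfolding mset_leaves sum_mset_sum_list[symmetric] mset_map by (rule arg_cong)

lemma tree_eval_nest_tree: "tree_eval tri g (nest_tree ls x) = spine tri g ls (g x)"
proof -
  have "tree_eval tri g (R (map (\<lambda>(y, w). (vertex y, w)) bs) z) = corolla tri g bs z" for bs z
    by (induction bs) auto
  then show ?thesis
    by (induction ls x rule: nest_tree.induct) auto
qed

lemma spine_append: "spine tri g (ls @ ms) e = spine tri g ls (spine tri g ms e)"
  by (induction ls) auto

lemma nest_nest_tree: "nest (nest_tree ls x)"
  by (induction ls x rule: nest_tree.induct) (auto intro!: nest.intros)

lemma nest_imp_nest_tree:
  assumes "nest u"
  obtains ls x where "u = nest_tree ls x"
proof -
  from assms have "\<exists>ls x. u = nest_tree ls x"
  proof (induction rule: nest.induct[case_names vertex level])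
    case (vertex z)
    then show ?case by (metis nest_tree.simps(1))
  next
    case (level y bs w z)
    then obtain ls x where y_eq: "y = nest_tree ls x" by blast
    let ?bs = "map (\<lambda>(y, w). (root y, w)) bs"
    have "map (\<lambda>(y, w). (vertex y, w)) ?bs = bs"
      unfolding map_map by (rule map_idI) (use level.hyps(2) in force)
    then have "R ((y, w) # bs) z = nest_tree ((w, ?bs, z) # ls) x"
      by (simp add: y_eq)
    then show ?case by blast
  qed
  then show thesis using that by blast
qed

section \<open>The leaf filtration\<close>

context nc_multi_novikov
begin

lemma tri_left_linear:
  "tri w (x + y) z = tri w x z + tri w y z" "tri w (x - y) z = tri w x z - tri w y z"
  "tri w (scale c x) z = scale c (tri w x z)" "tri w 0 z = 0"
proof -
  interpret Vector_Spaces.linear scale scale "\<lambda>x. tri w x z" by (rule linear_left)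
  show "tri w (x + y) z = tri w x z + tri w y z" "tri w (x - y) z = tri w x z - tri w y z"
    "tri w (scale c x) z = scale c (tri w x z)" "tri w 0 z = 0"
    by (fact add diff scale zero)+
qed

lemma tri_right_linear:
  "tri w z (x + y) = tri w z x + tri w z y" "tri w z (x - y) = tri w z x - tri w z y"
  "tri w z (scale c x) = scale c (tri w z x)" "tri w z 0 = 0"
proof -
  interpret Vector_Spaces.linear scale scale "\<lambda>x. tri w z x" by (rule linear_right)
  show "tri w z (x + y) = tri w z x + tri w z y" "tri w z (x - y) = tri w z x - tri w z y"
    "tri w z (scale c x) = scale c (tri w z x)" "tri w z 0 = 0"
    by (fact add diff scale zero)+
qed

lemma tri_span_in_subspace:
  assumes "x \<in> span A" "y \<in> span B" "subspace C" "\<And>a b. a \<in> A \<Longrightarrow> b \<in> B \<Longrightarrow> tri w a b \<in> C"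
  shows "tri w x y \<in> C"
proof -
  have generator: "tri w a y \<in> C" if "a \<in> A" for a
    using \<open>y \<in> span B\<close>
    by (induction rule: span_induct_alt)
      (use assms that in \<open>auto simp: tri_right_linear subspace_0 subspace_add subspace_scale\<close>)
  show ?thesis
    using \<open>x \<in> span A\<close>
    by (induction rule: span_induct_alt)
      (use assms generator in \<open>auto simp: tri_left_linear subspace_0 subspace_add subspace_scale\<close>)
qed

lemma linear_spine: "Vector_Spaces.linear scale scale (spine tri g ls)"
proof (induction ls)
  case Nil
  show ?case by (simp add: linear_ident)
next
  case (Cons l ls)
  obtain w bs z where "l = (w, bs, z)" by (cases l)
  then have "spine tri g (l # ls) = (\<lambda>x. tri w x (corolla tri g bs z)) \<circ> spine tri g ls"
    by auto
  then show ?case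
    using Vector_Spaces.linear_compose[OF Cons linear_left] by (simp only:)
qed

lemma spine_diff: "spine tri g ls (e - e') = spine tri g ls e - spine tri g ls e'"
proof -
  interpret Vector_Spaces.linear scale scale "spine tri g ls" by (rule linear_spine)
  show ?thesis by (rule diff)
qed

lemma spine_tri: "tri w (spine tri g ls e) u = spine tri g ls (tri w e u)"
  by (induction ls) (auto simp: right_commutative[of w])

lemma spine_mset_eq: "mset ls = mset ms \<Longrightarrow> spine tri g ls e = spine tri g ms e"
proof (induction ls arbitrary: ms)
  case Nil
  then show ?case by simp
next
  case (Cons l ls)
  obtain w bs z where l_eq: "l = (w, bs, z)" by (cases l)
  have "l \<in> set ms"
    using mset_eq_setD[OF Cons.prems] by auto
  then obtain us vs where ms_eq: "ms = us @ l # vs"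
    by (meson split_list)
  with Cons.prems have "mset ls = mset (us @ vs)"
    by simp
  then have "spine tri g ls e = spine tri g (us @ vs) e"
    by (rule Cons.IH)
  then show ?case
    by (simp add: ms_eq l_eq spine_append spine_tri)
qed

text \<open>As \<open>leaves\<close> omits the innermost leaf, the generators are the nests with at most \<open>k\<close> leaves.\<close>

definition nest_span :: "('x \<Rightarrow> 'n) \<Rightarrow> nat \<Rightarrow> 'n set" where
  "nest_span g k = span {spine tri g ls (g x) | ls x. length (leaves ls) < k}"

lemma subspace_nest_span [simp]: "subspace (nest_span g k)"
  by (simp add: nest_span_def)

lemma spine_in_nest_span: "length (leaves ls) < k \<Longrightarrow> spine tri g ls (g x) \<in> nest_span g k"
  unfolding nest_span_def by (intro span_base) blast

lemma nest_span_mono: "j \<le> k \<Longrightarrow> nest_span g j \<subseteq> nest_span g k"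
  unfolding nest_span_def by (intro span_mono) fastforce

lemma spine_nest_span:
  assumes "e \<in> nest_span g k"
  shows "spine tri g ls e \<in> nest_span g (length (leaves ls) + k)"
proof -
  interpret Vector_Spaces.linear scale scale "spine tri g ls" by (rule linear_spine)
  have leaves_append: "length (leaves (ls @ ms)) = length (leaves ls) + length (leaves ms)" for ms
    by (induction ls rule: leaves.induct) auto
  have "spine tri g ls e
      \<in> span (spine tri g ls ` {spine tri g ms (g x) | ms x. length (leaves ms) < k})"
    using assms by (simp add: nest_span_def span_image)
  also have "\<dots> \<subseteq> nest_span g (length (leaves ls) + k)"
    by (rule span_minimal)
      (auto intro!: spine_in_nest_span simp: leaves_append simp flip: spine_append)
  finally show ?thesis .
qed

lemma tri_corolla_nest_span:
  "e \<in> nest_span g k \<Longrightarrow> tri w e (corolla tri g bs z) \<in> nest_span g (length bs + k)"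
  using spine_nest_span[of e g k "[(w, bs, z)]"] by simp

lemma tri_two_levels:
  "tri w u (tri s (tri t v y) z) =
     tri s (tri w v (tri t u y)) z + tri t (tri w u (tri s v z)) y - tri t (tri w (tri s v z) u) y"
proof -
  have "tri w u (tri s (tri t v y) z) = tri w u (tri t (tri s v z) y)"
    by (simp only: right_commutative[of s t])
  also have "\<dots> = tri w (tri s v z) (tri t u y) + tri t (tri w u (tri s v z)) y
      - tri t (tri w (tri s v z) u) y"
    using left_symmetric[of t w u "tri s v z" y] by (simp add: algebra_simps)
  also have "tri w (tri s v z) (tri t u y) = tri s (tri w v (tri t u y)) z"
    by (rule right_commutative)
  finally show ?thesis .
qed

lemma tri_spine_spine:
  "tri w (spine tri g ls (g x)) (spine tri g ms (g y))
     \<in> nest_span g (length (leaves ls) + length (leaves ms) + 2)"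
proof (induction "length ls + length ms" arbitrary: w ls ms x y rule: less_induct)
  case less
  consider (vertex) "ms = []" | (level) s bs z where "ms = [(s, bs, z)]"
    | (levels) s bs z t cs v ns where "ms = (s, bs, z) # (t, cs, v) # ns"
    by (metis prod_cases3 remdups_adj.cases)
  then show ?case
  proof cases
    case vertex
    then show ?thesis
      using spine_in_nest_span[of "(w, [], y) # ls" _ g x] by simp
  next
    case level
    then show ?thesis
      using spine_in_nest_span[of "(w, (y, s) # bs, z) # ls" _ g x] by simp
  next
    case levels
    let ?u = "spine tri g ls (g x)" and ?v = "spine tri g ns (g y)"
    let ?B = "corolla tri g cs v" and ?Z = "corolla tri g bs z"
    let ?N = "nest_span g (length (leaves ls) + length (leaves ms) + 2)"
    have "tri s (tri w ?v (tri t ?u ?B)) ?Z \<in> ?N"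
      using tri_corolla_nest_span[OF less[of ns "(t, cs, v) # ls" w y x], of s bs z]
      by (simp add: levels ac_simps)
    moreover have "tri t (tri w ?u (tri s ?v ?Z)) ?B \<in> ?N"
      using tri_corolla_nest_span[OF less[of ls "(s, bs, z) # ns" w x y], of t cs v]
      by (simp add: levels ac_simps)
    moreover have "tri t (tri w (tri s ?v ?Z) ?u) ?B \<in> ?N"
      using tri_corolla_nest_span[OF less[of "(s, bs, z) # ns" ls w y x], of t cs v]
      by (simp add: levels ac_simps)
    ultimately have "tri s (tri w ?v (tri t ?u ?B)) ?Z + tri t (tri w ?u (tri s ?v ?Z)) ?B
        - tri t (tri w (tri s ?v ?Z) ?u) ?B \<in> ?N"
      by (intro subspace_diff subspace_add subspace_nest_span)
    then show ?thesis
      by (simp add: levels tri_two_levels[of w ?u s t ?v ?B ?Z])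
  qed
qed

lemma tri_nest_span:
  assumes "x \<in> nest_span g j" "y \<in> nest_span g k"
  shows "tri w x y \<in> nest_span g (j + k)"
proof (rule tri_span_in_subspace)
  fix a b
  assume "a \<in> {spine tri g ls (g x) | ls x. length (leaves ls) < j}"
    and "b \<in> {spine tri g ls (g x) | ls x. length (leaves ls) < k}"
  then obtain ls x ms y where "a = spine tri g ls (g x)" "b = spine tri g ms (g y)"
    and "length (leaves ls) + length (leaves ms) + 2 \<le> j + k"
    by auto
  then show "tri w a b \<in> nest_span g (j + k)"
    using tri_spine_spine[of w g ls x ms y] nest_span_mono by auto
qed (use assms in \<open>simp_all add: nest_span_def\<close>)

lemma tree_eval_in_nest_span: "\<exists>k. tree_eval tri g u \<in> nest_span g k"
proof (induction u rule: mtree_graft_induct)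
  case (vertex z)
  then show ?case
    using spine_in_nest_span[of "[]" 1 g z] by auto
next
  case (graft w u v)
  then show ?case
    using tri_nest_span tree_eval_graft by metis
qed

end

section \<open>Permuting the leaves of a nest\<close>

lemma swap_hd_obtain_last:
  assumes "c \<in> set ys" "\<And>xs. P xs xs"
    and trans: "\<And>xs ys zs. P xs ys \<Longrightarrow> P ys zs \<Longrightarrow> P xs zs"
    and swap: "\<And>a us b vs. P (a # us @ b # vs) (b # us @ a # vs)"
  obtains zs where "mset (zs @ [c]) = mset ys" "P (zs @ [c]) ys"
proof -
  from assms(1) consider (last) us where "ys = us @ [c]" | (hd) us d where "ys = c # us @ [d]"
    | (inner) a us vs d where "ys = a # us @ c # vs @ [d]"
    by (metis append_Cons neq_Nil_conv rev_exhaust self_append_conv2 split_list)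
  then show thesis
  proof cases
    case last
    then show thesis using that[of us] assms(2) by simp
  next
    case hd
    then show thesis using that[of "d # us"] swap[of d us c "[]"] by simp
  next
    case inner
    have "P (a # us @ d # vs @ [c]) (c # us @ d # vs @ [a])"
      using swap[of a "us @ d # vs" c "[]"] by simp
    moreover have "P (c # us @ d # vs @ [a]) (d # us @ c # vs @ [a])"
      by (rule swap)
    moreover have "P (d # us @ c # vs @ [a]) ys"
      using swap[of d "us @ c # vs" a "[]"] inner by simp
    ultimately have "P (a # us @ d # vs @ [c]) ys"
      by (blast intro: trans)
    then show thesis using that[of "a # us @ d # vs"] inner by simp
  qed
qed

lemma mset_eq_swap_hd_induct [consumes 1, case_names refl trans swap]:
  assumes "mset xs = mset ys"
    and "\<And>xs. P xs xs"
    and "\<And>xs ys zs. P xs ys \<Longrightarrow> P ys zs \<Longrightarrow> P xs zs"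
    and "\<And>a us b vs. P (a # us @ b # vs) (b # us @ a # vs)"
  shows "P xs ys"
  using assms
proof (induction xs arbitrary: ys P rule: rev_induct)
  case Nil
  then show ?case by simp
next
  case (snoc c xs)
  have "c \<in> set ys"
    using mset_eq_setD[OF snoc.prems(1)] by auto
  then obtain zs where zs: "mset (zs @ [c]) = mset ys" "P (zs @ [c]) ys"
    using snoc.prems(2-4) by (rule swap_hd_obtain_last)
  then have "mset xs = mset zs"
    using snoc.prems(1) by (metis add_right_imp_eq mset_append)
  then have "P (xs @ [c]) (zs @ [c])"
  proof (rule snoc.IH)
    show "P ((a # us @ b # vs) @ [c]) ((b # us @ a # vs) @ [c])" for a us b vs
      using snoc.prems(4)[of a us b "vs @ [c]"] by simp
  qed (fact snoc.prems(2), erule (1) snoc.prems(3))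
  then show ?case
    using zs(2) by (rule snoc.prems(3))
qed

context nc_multi_novikov
begin

lemma corolla_swap_hd:
  "corolla tri g ((a, w) # (b, t) # bs) z - corolla tri g ((b, w) # (a, t) # bs) z
     \<in> nest_span g (Suc (length bs))"
proof -
  let ?Z = "corolla tri g bs z"
  have "tri w (g a) (tri t (g b) ?Z) - tri w (g b) (tri t (g a) ?Z) =
      tri t (tri w (g a) (g b)) ?Z - tri t (tri w (g b) (g a)) ?Z"
    using left_symmetric[of t w "g a" "g b" ?Z] by (simp add: algebra_simps)
  also have "\<dots> \<in> nest_span g (Suc (length bs))"
    using spine_in_nest_span[of "[(t, bs, z), (w, [], b)]" _ g a]
      spine_in_nest_span[of "[(t, bs, z), (w, [], a)]" _ g b]
    by (intro subspace_diff) auto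
  finally show ?thesis by simp
qed

lemma corolla_exchange:
  "corolla tri g ((a, w) # us @ (b, t) # bs) z - corolla tri g ((b, w) # us @ (a, t) # bs) z
     \<in> nest_span g (Suc (length us + length bs))"
proof (induction us arbitrary: w)
  case Nil
  then show ?case using corolla_swap_hd by simp
next
  case (Cons u us)
  obtain c s where u_eq: "u = (c, s)" by (cases u)
  let ?C = "\<lambda>x y v. corolla tri g ((x, w) # (y, s) # us @ (v, t) # bs) z"
  have "g c \<in> nest_span g 1"
    using spine_in_nest_span[of "[]" 1 g c] by simp
  from tri_nest_span[OF this Cons]
  have "?C c a b - ?C c b a \<in> nest_span g (Suc (length (u # us) + length bs))"
    by (simp add: tri_right_linear)
  moreover have "?C a c b - ?C c a b \<in> nest_span g (Suc (length (u # us) + length bs))"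
    "?C c b a - ?C b c a \<in> nest_span g (Suc (length (u # us) + length bs))"
    using corolla_swap_hd[of g _ w _ s "us @ (_, t) # bs" z] by simp_all
  ultimately have "(?C a c b - ?C c a b) + (?C c a b - ?C c b a) + (?C c b a - ?C b c a)
      \<in> nest_span g (Suc (length (u # us) + length bs))"
    by (intro subspace_add subspace_nest_span)
  then show ?case by (simp add: u_eq)
qed

lemma spine_exchange:
  "spine tri g ((w, us @ (b, t) # bs, z) # ls) (g a)
       - spine tri g ((w, us @ (a, t) # bs, z) # ls) (g b)
     \<in> nest_span g (length (leaves ((w, us @ (b, t) # bs, z) # ls)))"
proof -
  have "spine tri g ((w, us @ (y, t) # bs, z) # ls) (g x) =
      spine tri g ls (corolla tri g ((x, w) # us @ (y, t) # bs) z)" for x y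
    by (simp add: spine_tri)
  then show ?thesis
    using spine_nest_span[OF corolla_exchange, of g ls a w us b t bs z] by (simp add: spine_diff)
qed

end

text \<open>
  The shape of a level is the variable \<open>(\<partial>\<^sub>\<omega>\<^sub>1 \<dots> \<partial>\<^sub>\<omega>\<^sub>n)(z)\<close> that it contributes to the leading
  monomial.
\<close>

fun shape :: "('x, 'o) level \<Rightarrow> 'o list \<times> 'x" where
  "shape (w, bs, z) = (w # map snd bs, z)"

fun refill :: "('x, 'o) level list \<Rightarrow> 'x list \<Rightarrow> ('x, 'o) level list" where
  "refill [] xs = []"
| "refill ((w, bs, z) # ls) xs =
     (w, zip (drop (length (leaves ls)) xs) (map snd bs), z)
       # refill ls (take (length (leaves ls)) xs)"

lemma leaves_refill: "length xs = length (leaves ls) \<Longrightarrow> leaves (refill ls xs) = xs"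
  by (induction ls xs rule: refill.induct) auto

lemma map_shape_refill:
  "length xs = length (leaves ls) \<Longrightarrow> map shape (refill ls xs) = map shape ls"
  by (induction ls xs rule: refill.induct) auto

lemma length_leaves_eq_sum_shape: "length (leaves ls) = (\<Sum>v\<leftarrow>map shape ls. length (fst v) - 1)"
  by (induction ls rule: leaves.induct) auto

lemma refill_leaves:
  "map shape ls = map shape ms \<Longrightarrow> refill ls (leaves ms) = ms"
proof (induction ls arbitrary: ms)
  case (Cons l ls)
  then obtain m ms'
    where ms_split: "ms = m # ms'" "shape l = shape m" "map shape ls = map shape ms'"
    by auto
  then have "length (leaves ls) = length (leaves ms')"
    by (simp only: length_leaves_eq_sum_shape)
  with Cons.IH[OF ms_split(3)] ms_split show ?case
    by (cases l; cases m) (auto simp: zip_map_fst_snd)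
qed simp

context nc_multi_novikov
begin

lemma spine_refill_exchange:
  assumes "Suc (length us + length vs) = length (leaves ls)"
  shows "spine tri g (refill ls (us @ b # vs)) (g a) - spine tri g (refill ls (us @ a # vs)) (g b)
    \<in> nest_span g (length (leaves ls))"
  using assms
proof (induction ls arbitrary: us vs)
  case Nil
  then show ?case by simp
next
  case (Cons l ls)
  obtain w bs z where l_eq: "l = (w, bs, z)" by (cases l)
  let ?n = "length (leaves ls)"
  show ?case
  proof (cases "length us < ?n")
    case True
    define ds where "ds = drop (?n - Suc (length us)) vs"
    let ?E = "\<lambda>x y. spine tri g (refill ls (us @ y # take (?n - Suc (length us)) vs)) (g x)"
    let ?C = "corolla tri g (zip ds (map snd bs)) z"
    have "?E a b - ?E b a \<in> nest_span g ?n"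
      using True Cons.prems by (intro Cons.IH) (simp add: l_eq)
    then have "tri w (?E a b) ?C - tri w (?E b a) ?C
        \<in> nest_span g (length (zip ds (map snd bs)) + ?n)"
      unfolding tri_left_linear(2)[symmetric] by (rule tri_corolla_nest_span)
    moreover have "spine tri g (refill (l # ls) (us @ y # vs)) (g x) = tri w (?E x y) ?C" for x y
      using True by (simp add: l_eq ds_def take_Cons' drop_Cons')
    ultimately show ?thesis
      using True Cons.prems by (simp add: l_eq ds_def add.commute)
  next
    case False
    let ?us = "drop ?n us"
    have "length ?us < length (map snd bs)"
      using False Cons.prems by (simp add: l_eq)
    then obtain ts t ts'
      where bs_eq: "map snd bs = ts @ t # ts'" and length_ts: "length ts = length ?us"
      by (metis id_take_nth_drop length_take min.absorb4)
    have "refill (l # ls) (us @ y # vs) =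
        (w, zip ?us ts @ (y, t) # zip vs ts', z) # refill ls (take ?n us)" for y
      using False by (simp add: l_eq bs_eq length_ts zip_append)
    moreover have "length bs = Suc (length ts + length ts')"
      using arg_cong[OF bs_eq, of length] by simp
    ultimately show ?thesis
      using spine_exchange[of g w "zip ?us ts" b t "zip vs ts'" z "refill ls (take ?n us)" a]
        False Cons.prems length_ts by (simp add: l_eq leaves_refill ac_simps)
  qed
qed

lemma spine_refill_mset_eq:
  assumes "mset (x # xs) = mset (y # ys)" "length xs = length (leaves ls)"
  shows "spine tri g (refill ls xs) (g x) - spine tri g (refill ls ys) (g y)
    \<in> nest_span g (length (leaves ls))"
proof -
  define E where "E xs = spine tri g (refill ls (tl xs)) (g (hd xs))" for xs
  have "length xs = Suc (length (leaves ls)) \<longrightarrow>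
      length ys = Suc (length (leaves ls)) \<and> E xs - E ys \<in> nest_span g (length (leaves ls))"
    if "mset xs = mset ys" for xs ys
    using that
  proof (induction rule: mset_eq_swap_hd_induct)
    case (refl xs)
    then show ?case by (simp add: subspace_0)
  next
    case (trans xs ys zs)
    then show ?case
      using subspace_add[OF subspace_nest_span, of "E xs - E ys" _ _ "E ys - E zs"] by auto
  next
    case (swap a us b vs)
    then show ?case
      using spine_refill_exchange[of us vs ls g b a] by (simp add: E_def)
  qed
  from this[OF assms(1)] assms(2) show ?thesis
    by (simp add: E_def)
qed

end

section \<open>Spanning by noncommuting multi-Novikov elements\<close>

fun shape_key :: "'o list \<times> 'x \<Rightarrow> nat \<times> 'x \<times> 'o list" where
  "shape_key (ws, z) = (length ws, z, ws)"

lemma inj_shape_key: "inj shape_key"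
  by (auto simp: inj_def)

lemma lexordp_eq_iff_le: "lexordp_eq xs ys \<longleftrightarrow> xs \<le> (ys :: 'o::linorder list)"
  by (simp add: lexordp_eq_conv_lexord list_le_def list_less_def lexordp_conv_lexord disj_commute)

lemma ordered_nest_Cons:
  "ordered_nest (nest_tree (l # l' # ls) x) \<longleftrightarrow>
     ordered_nest (nest_tree (l' # ls) x) \<and> shape_key (shape l) \<le> shape_key (shape l')"
    (is "?outer \<longleftrightarrow> ?inner \<and> ?le")
proof -
  obtain w bs z w' bs' z' where l_eq: "l = (w, bs, z)" "l' = (w', bs', z')"
    by (cases l; cases l')
  have snd_vertex: "snd \<circ> (\<lambda>(y, w). (vertex y, w)) = snd"
    by auto
  show ?thesis
  proof
    assume ?outer
    then show "?inner \<and> ?le"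
      unfolding l_eq by cases (auto simp: snd_vertex lexordp_eq_iff_le)
  next
    assume "?inner \<and> ?le"
    then have inner: "ordered_nest (nest_tree ((w', bs', z') # ls) x)"
      by (simp add: l_eq)
    note first_branch = nest_nest_tree nest_tree.simps(2) nest_tree.simps(2)
    from \<open>?inner \<and> ?le\<close> consider (longer) "length bs < length bs'"
      | (root) "length bs = length bs'" "z < z'"
      | (lex) "length bs = length bs'" "z = z'" "lexordp_eq (w # map snd bs) (w' # map snd bs')"
      unfolding lexordp_eq_iff_le by (fastforce simp: l_eq)
    then show ?outer
    proof cases
      case longer
      then show ?thesis
        unfolding l_eq
        by (intro ordered_nest.longer[OF first_branch]) (simp_all add: inner[simplified])
    next
      case root
      then show ?thesis
        unfolding l_eq
        by (intro ordered_nest.root[OF first_branch]) (simp_all add: inner[simplified])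
    next
      case lex
      then show ?thesis
        unfolding l_eq
        by (intro ordered_nest.lex[OF first_branch]) (simp_all add: inner[simplified] snd_vertex)
    qed
  qed
qed

lemma ordered_nest_iff_sorted:
  "ordered_nest (nest_tree ls x) \<longleftrightarrow> sorted (map (shape_key \<circ> shape) ls)"
proof (induction ls rule: induct_list012[case_names Nil single Cons])
  case Nil
  show ?case by (simp add: ordered_nest.single)
next
  case (single l)
  obtain w bs z where "l = (w, bs, z)" by (cases l)
  then show ?case
    using ordered_nest.leaf[OF nest_nest_tree nest_tree.simps(2) nest_tree.simps(1)] by simp
next
  case (Cons l l' ls)
  then show ?case
    unfolding ordered_nest_Cons by auto
qed

lemma nest_tree_in_MNE_iff:
  "nest_tree ls x \<in> MNE \<longleftrightarrow>
     sorted (map (shape_key \<circ> shape) ls) \<and> sorted (rev (x # leaves ls))"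
  by (simp add: MNE_def ordered_nest_iff_sorted leaf_seq_nest_tree)

lemma ordered_nest_imp_nest: "ordered_nest u \<Longrightarrow> nest u"
  by (cases rule: ordered_nest.cases) (auto intro: nest.intros)

lemma MNE_imp_nest_tree:
  assumes "u \<in> MNE"
  obtains ls x where "u = nest_tree ls x"
proof -
  have "nest u"
    using assms by (simp add: MNE_def ordered_nest_imp_nest)
  then show thesis
    using that by (rule nest_imp_nest_tree)
qed

context
  fixes scale :: "'k::field \<Rightarrow> 'n::ab_group_add \<Rightarrow> 'n" and tri :: "'o::linorder \<Rightarrow> 'n \<Rightarrow> 'n \<Rightarrow> 'n"
    and g :: "'x::linorder \<Rightarrow> 'n"
  assumes nc_multi_novikov: "nc_multi_novikov scale tri"
begin

interpretation nc_multi_novikov scale tri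
  by (rule nc_multi_novikov)

lemma spine_cong_MNE:
  "\<exists>u\<in>MNE. spine tri g ls (g x) - tree_eval tri g u \<in> nest_span g (length (leaves ls))"
proof -
  define ms where "ms = sort_key (shape_key \<circ> shape) ls"
  have "mset ms = mset ls"
    by (simp add: ms_def)
  obtain y ys where ys_eq: "rev (sort (x # leaves ms)) = y # ys"
    by (metis list.exhaust length_0_conv length_rev length_sort list.discI)
  then have mset_ys: "mset (x # leaves ms) = mset (y # ys)"
    by (metis mset_rev mset_sort)
  then have length_ys: "length ys = length (leaves ms)"
    by (metis Suc_inject length_Cons size_mset)
  have "sorted (map (shape_key \<circ> shape) ms)"
    unfolding ms_def by (rule sorted_sort_key)
  moreover have "sorted (rev (y # ys))"
    unfolding ys_eq[symmetric] by (simp del: sort_key_simps)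
  ultimately have "nest_tree (refill ms ys) y \<in> MNE"
    unfolding nest_tree_in_MNE_iff leaves_refill[OF length_ys] map_map[symmetric]
      map_shape_refill[OF length_ys]
    by (rule conjI)
  moreover have "spine tri g (refill ms (leaves ms)) (g x) - spine tri g (refill ms ys) (g y)
      \<in> nest_span g (length (leaves ms))"
    using spine_refill_mset_eq[OF mset_ys] by simp
  moreover have "length (leaves ms) = length (leaves ls)"
    using mset_leaves_cong[OF \<open>mset ms = mset ls\<close>] by (metis size_mset)
  ultimately show ?thesis
    using spine_mset_eq[OF \<open>mset ms = mset ls\<close>] by (metis refill_leaves tree_eval_nest_tree)
qed

lemma nest_span_subset_span_MNE: "nest_span g k \<subseteq> span (tree_eval tri g ` MNE)"
proof (induction k)
  case 0
  then show ?case by (simp add: nest_span_def span_zero)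
next
  case (Suc k)
  have "spine tri g ls (g x) \<in> span (tree_eval tri g ` MNE)" if "length (leaves ls) \<le> k" for ls x
  proof -
    obtain u where "u \<in> MNE"
      and "spine tri g ls (g x) - tree_eval tri g u \<in> nest_span g (length (leaves ls))"
      using spine_cong_MNE by blast
    moreover from this
    have "spine tri g ls (g x) - tree_eval tri g u \<in> span (tree_eval tri g ` MNE)"
      using Suc nest_span_mono[OF that] by blast
    ultimately show ?thesis
      using span_add[OF _ span_base] by fastforce
  qed
  then show ?case
    unfolding nest_span_def by (intro span_minimal) auto
qed

lemma tree_eval_in_span_MNE: "tree_eval tri g u \<in> span (tree_eval tri g ` MNE)"
  using tree_eval_in_nest_span nest_span_subset_span_MNE by blast

end

section \<open>Leading monomials of nests\<close>

lemma nc_multi_novikov_dpoly: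
  "nc_multi_novikov kscale (dpoly_tri :: 'o \<Rightarrow> ('x, 'o, 'k::field) dpoly \<Rightarrow> _)"
proof
  fix w t :: 'o and x y z :: "('x, 'o, 'k) dpoly" and c :: 'k
  show "dpoly_tri t (dpoly_tri w x y) z - dpoly_tri w x (dpoly_tri t y z) =
      dpoly_tri t (dpoly_tri w y x) z - dpoly_tri w y (dpoly_tri t x z)"
    by (simp add: dpoly_tri_def D_mult algebra_simps)
  show "dpoly_tri t (dpoly_tri w x y) z = dpoly_tri w (dpoly_tri t x z) y"
    by (simp add: dpoly_tri_def algebra_simps)
qed (simp_all add: dpoly_tri_def D_def lin_ext_add lin_ext_scale kscale_mult_left kscale_mult_right
      algebra_simps)

context
  notes One_nat_def [simp del]
begin

definition underived :: "(('o list \<times> 'x) \<Rightarrow>\<^sub>0 nat) \<Rightarrow> nat" where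
  "underived m = (\<Sum>v | v \<in> Poly_Mapping.keys m \<and> fst v = []. Poly_Mapping.lookup m v)"

lemma underived_superset:
  assumes "finite A" "Poly_Mapping.keys m \<subseteq> A"
  shows "underived m = (\<Sum>v | v \<in> A \<and> fst v = []. Poly_Mapping.lookup m v)"
  unfolding underived_def
  by (rule sum.mono_neutral_left) (use assms in \<open>auto simp: in_keys_iff\<close>)

lemma underived_add: "underived (m + n) = underived m + underived n"
  by (simp add: underived_superset[of "Poly_Mapping.keys m \<union> Poly_Mapping.keys n"]
      Poly_Mapping.keys_add lookup_add sum.distrib)

lemma underived_zero [simp]: "underived 0 = 0"
  by (simp add: underived_def)

lemma underived_single [simp]:
  "underived (Poly_Mapping.single v n) = (if fst v = [] then n else 0)"
proof -
  have "{u. u \<in> {v} \<and> fst u = []} = (if fst v = [] then {v} else {})"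
    by auto
  then show ?thesis
    by (simp add: underived_superset[of "{v}"])
qed

definition underived_below :: "nat \<Rightarrow> ('x, 'o, 'k::field) dpoly set" where
  "underived_below k = {p. \<forall>m\<in>Poly_Mapping.keys p. underived m < k}"

lemma subspace_underived_below: "kspace.subspace (underived_below k)"
proof (rule kspace.subspaceI)
  fix p q :: "('x, 'o, 'k::field) dpoly" and c :: 'k
  show "0 \<in> underived_below k" by (simp add: underived_below_def)
  show "p + q \<in> underived_below k" if "p \<in> underived_below k" "q \<in> underived_below k"
    using that Poly_Mapping.keys_add[of p q] by (auto simp: underived_below_def)
  show "kscale c p \<in> underived_below k" if "p \<in> underived_below k"
    using that by (auto simp: underived_below_def in_keys_iff)
qed

lemmas underived_below_zero = kspace.subspace_0[OF subspace_underived_below]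
  and underived_below_add = kspace.subspace_add[OF subspace_underived_below]
  and underived_below_sum = kspace.subspace_sum[OF subspace_underived_below]
  and underived_below_scale = kspace.subspace_scale[OF subspace_underived_below]

lemma underived_below_mono: "p \<in> underived_below j \<Longrightarrow> j \<le> k \<Longrightarrow> p \<in> underived_below k"
  by (auto simp: underived_below_def)

lemma single_in_underived_below: "underived m < k \<Longrightarrow> Poly_Mapping.single m c \<in> underived_below k"
  by (simp add: underived_below_def)

lemma underived_below_mult:
  assumes "p \<in> underived_below (Suc i)" "q \<in> underived_below k"
  shows "p * q \<in> underived_below (i + k)"
proof -
  have "underived (a + b) < i + k" if "a \<in> Poly_Mapping.keys p" "b \<in> Poly_Mapping.keys q" for a b
    using assms that unfolding underived_below_def underived_add by fastforce
  then show ?thesis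
    unfolding underived_below_def using Poly_Mapping.keys_mult[of p q] by blast
qed

lemma deriv_monom_eq_sum_single:
  "deriv_monom w m = (\<Sum>v\<in>Poly_Mapping.keys m.
     Poly_Mapping.single (m - Poly_Mapping.single v 1 + Poly_Mapping.single (w # fst v, snd v) 1)
       (of_nat (Poly_Mapping.lookup m v)))"
  by (simp add: deriv_monom_def dvar_def case_prod_unfold mult_single flip: single_of_nat)

lemma underived_deriv_summand:
  assumes "v \<in> Poly_Mapping.keys m"
  shows "underived (m - Poly_Mapping.single v 1 + Poly_Mapping.single (w # ws, x) 1) =
    underived m - (if fst v = [] then 1 else 0)"
proof -
  have "m - Poly_Mapping.single v 1 + Poly_Mapping.single v 1 = m"
    by (rule poly_mapping_eqI)
      (use assms in \<open>auto simp: lookup_add lookup_minus lookup_single when_def in_keys_iff\<close>)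
  then have "underived m = underived (m - Poly_Mapping.single v 1) + (if fst v = [] then 1 else 0)"
    using underived_add[of "m - Poly_Mapping.single v 1" "Poly_Mapping.single v 1"] by simp
  then show ?thesis
    by (simp add: underived_add)
qed

lemma D_diff: "D w (p - q) = D w p - D w q"
proof -
  interpret Vector_Spaces.linear kscale kscale "D w" by (rule linear_D)
  show ?thesis by (rule diff)
qed

lemma deriv_monom_in_underived_below: "underived m < k \<Longrightarrow> deriv_monom w m \<in> underived_below k"
  unfolding deriv_monom_eq_sum_single
  by (intro underived_below_sum single_in_underived_below)
    (simp add: underived_deriv_summand less_imp_diff_less)

lemma D_in_underived_below: "p \<in> underived_below k \<Longrightarrow> D w p \<in> underived_below k"
  unfolding D_def lin_ext_def
  by (intro underived_below_sum underived_below_scale deriv_monom_in_underived_below)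
    (simp add: underived_below_def)

lemma deriv_underived_monom_in_underived_below:
  assumes "fst ` Poly_Mapping.keys m \<subseteq> {[]}"
  shows "deriv_monom w m \<in> underived_below (underived m)"
  unfolding deriv_monom_eq_sum_single
proof (intro underived_below_sum single_in_underived_below)
  fix v
  assume v_key: "v \<in> Poly_Mapping.keys m"
  with assms have "fst v = []"
    by auto
  moreover from this v_key have "0 < underived m"
    by (auto simp: underived_def in_keys_iff intro!: sum_pos)
  ultimately
  show "underived (m - Poly_Mapping.single v 1 + Poly_Mapping.single (w # fst v, snd v) 1)
      < underived m"
    by (simp only: underived_deriv_summand[OF v_key]) simp
qed

definition leading_monom ::
    "('x, 'o, 'k::field) dpoly \<Rightarrow> (('o list \<times> 'x) \<Rightarrow>\<^sub>0 nat) \<Rightarrow> bool" where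
  "leading_monom p m \<longleftrightarrow> p - basis_elem m \<in> underived_below (underived m)"

lemma leading_monom_in_keys:
  assumes "leading_monom p m"
  shows "m \<in> Poly_Mapping.keys p"
proof -
  have "m \<notin> Poly_Mapping.keys (p - basis_elem m)"
    using assms by (auto simp: leading_monom_def underived_below_def)
  then show ?thesis
    by (simp add: in_keys_iff lookup_minus)
qed

lemma leading_monom_underived_less:
  "leading_monom p m \<Longrightarrow> n \<in> Poly_Mapping.keys p \<Longrightarrow> n \<noteq> m \<Longrightarrow> underived n < underived m"
  by (auto simp: leading_monom_def underived_below_def in_keys_iff lookup_minus
      lookup_single_not_eq)

lemma leading_monom_dvar: "leading_monom (dvar ws x) (Poly_Mapping.single (ws, x) 1)"
  by (simp add: leading_monom_def dvar_def underived_below_zero)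

lemma leading_monom_add_below:
  assumes "leading_monom p m" "q \<in> underived_below (underived m)"
  shows "leading_monom (p + q) m"
  using underived_below_add[OF assms(1)[unfolded leading_monom_def] assms(2)]
  by (simp add: leading_monom_def diff_add_eq)

lemma leading_monom_imp_underived_below:
  assumes "leading_monom p m"
  shows "p \<in> underived_below (Suc (underived m))"
proof -
  have "p - basis_elem m \<in> underived_below (Suc (underived m))"
    using assms underived_below_mono unfolding leading_monom_def by fastforce
  from underived_below_add[OF this single_in_underived_below[of m _ 1]] show ?thesis
    by simp
qed

lemma leading_monom_mult:
  assumes "leading_monom p m" "leading_monom q n"
  shows "leading_monom (p * q) (m + n)"
proof -
  have "p * (q - basis_elem n) \<in> underived_below (underived m + underived n)"
    using assms leading_monom_imp_underived_below underived_below_mult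
    unfolding leading_monom_def by blast
  moreover have "basis_elem n * (p - basis_elem m) \<in> underived_below (underived n + underived m)"
    using assms(1) single_in_underived_below[of n "Suc (underived n)"] underived_below_mult
    unfolding leading_monom_def by blast
  moreover have "p * q - basis_elem (m + n) =
      p * (q - basis_elem n) + basis_elem n * (p - basis_elem m)"
    using mult_single[of m 1 n "1 :: 'c"] by (simp add: algebra_simps)
  ultimately show ?thesis
    by (simp add: leading_monom_def underived_add underived_below_add add.commute)
qed

lemma leading_monom_D:
  fixes p :: "('x, 'o, 'k::field) dpoly"
  assumes "leading_monom p (m + Poly_Mapping.single (ws, x) 1)" "ws \<noteq> []"
    and "fst ` Poly_Mapping.keys m \<subseteq> {[]}"
  shows "leading_monom (D w p) (m + Poly_Mapping.single (w # ws, x) 1)"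
proof -
  let ?v = "Poly_Mapping.single (ws, x) (1::nat)"
  let ?wv = "Poly_Mapping.single (w # ws, x) (1::nat)"
  let ?Dm = "deriv_monom w m :: ('x, 'o, 'k) dpoly"
  have "D w (p - basis_elem (m + ?v)) \<in> underived_below (underived m)"
    using assms(1,2) by (intro D_in_underived_below) (simp add: leading_monom_def underived_add)
  moreover have "basis_elem ?v * ?Dm \<in> underived_below (0 + underived m)"
    using assms(2,3)
    by (intro underived_below_mult single_in_underived_below
        deriv_underived_monom_in_underived_below) simp_all
  moreover have "D w p - basis_elem (m + ?wv) =
      D w (p - basis_elem (m + ?v)) + basis_elem ?v * ?Dm"
  proof -
    have "deriv_monom w ?v = (dvar (w # ws) x :: ('x, 'o, 'k) dpoly)"
      using D_dvar[of w ws x] by (simp add: D_def dvar_def)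
    then have "D w (basis_elem (m + ?v)) =
        (basis_elem (m + ?wv) + basis_elem ?v * ?Dm :: ('x, 'o, 'k) dpoly)"
      unfolding D_def lin_ext_basis_elem deriv_monom_add by (simp add: dvar_def mult_single)
    then show ?thesis
      by (simp add: D_diff)
  qed
  ultimately show ?thesis
    by (simp add: leading_monom_def underived_add underived_below_add)
qed

abbreviation list_monom :: "'v list \<Rightarrow> 'v \<Rightarrow>\<^sub>0 nat" where
  "list_monom vs \<equiv> \<Sum>v\<leftarrow>vs. Poly_Mapping.single v 1"

lemma lookup_list_monom: "Poly_Mapping.lookup (list_monom vs) v = count (mset vs) v"
  by (induction vs) (auto simp: lookup_add lookup_single)

lemma keys_list_monom: "Poly_Mapping.keys (list_monom vs) = set vs"
  by (auto simp: in_keys_iff lookup_list_monom)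

lemma list_monom_eqD: "list_monom us = list_monom vs \<Longrightarrow> mset us = mset vs"
  by (rule multiset_eqI) (metis lookup_list_monom)

lemma leading_monom_D_corolla:
  "leading_monom (D w (corolla dpoly_tri (dvar []) bs z) :: ('x, 'o, 'k::field) dpoly)
     (list_monom (map (Pair []) (map fst bs)) + Poly_Mapping.single (w # map snd bs, z) 1)"
proof (induction bs arbitrary: w)
  case Nil
  then show ?case
    by (simp add: D_dvar leading_monom_dvar)
next
  case (Cons b bs)
  obtain y t where b_eq: "b = (y, t)" by (cases b)
  let ?p = "D t (corolla dpoly_tri (dvar []) bs z) :: ('x, 'o, 'k) dpoly"
  let ?m = "list_monom (map (Pair []) (map fst bs)) :: ('o list \<times> 'x) \<Rightarrow>\<^sub>0 nat"
  let ?y = "Poly_Mapping.single ([], y) (1::nat)"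
  let ?v = "Poly_Mapping.single (w # t # map snd bs, z) (1::nat)"
  have "leading_monom (D w ?p) (?m + ?v)"
    using Cons[of t] by (rule leading_monom_D) (auto simp: keys_list_monom simp del: map_map)
  with leading_monom_dvar
  have "leading_monom (dvar [] y * D w ?p) (?y + (?m + ?v))"
    by (rule leading_monom_mult)
  moreover have "dvar [w] y * ?p \<in> underived_below (0 + Suc (underived ?m))"
  proof (rule underived_below_mult)
    show "dvar [w] y \<in> underived_below (Suc 0)"
      unfolding dvar_def by (rule single_in_underived_below) simp
    show "?p \<in> underived_below (Suc (underived ?m))"
      using leading_monom_imp_underived_below[OF Cons[of t]] by (simp add: underived_add)
  qed
  ultimately have "leading_monom (dvar [] y * D w ?p + dvar [w] y * ?p)
      (?y + (?m + ?v))"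
    by (intro leading_monom_add_below) (simp_all add: underived_add plus_1_eq_Suc)
  then show ?case
    by (simp add: b_eq dpoly_tri_def[of t] D_mult D_dvar ac_simps)
qed

fun nest_vars :: "('x, 'o) mtree \<Rightarrow> ('o list \<times> 'x) list" where
  "nest_vars (R [] x) = [([], x)]"
| "nest_vars (R ((u, w) # bs) z) =
     nest_vars u @ map (\<lambda>(y, w). ([], root y)) bs @ [(w # map snd bs, z)]"

lemma nest_vars_nest_tree [simp]:
  "nest_vars (nest_tree ((w, bs, z) # ls) x) =
     nest_vars (nest_tree ls x) @ map (Pair []) (map fst bs) @ [shape (w, bs, z)]"
  by (simp add: comp_def case_prod_unfold)

lemma leading_monom_nest_tree:
  "leading_monom (tree_eval dpoly_tri (dvar []) (nest_tree ls x))
     (list_monom (nest_vars (nest_tree ls x)))"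
  unfolding tree_eval_nest_tree
proof (induction ls)
  case Nil
  then show ?case
    by (simp add: leading_monom_dvar)
next
  case (Cons l ls)
  obtain w bs z where "l = (w, bs, z)" by (cases l)
  then show ?case
    using leading_monom_mult[OF Cons leading_monom_D_corolla, of w bs z]
    by (simp add: dpoly_tri_def[of w] del: nest_tree.simps)
qed

lemma mset_nest_vars:
  "mset (nest_vars (nest_tree ls x)) =
     image_mset (Pair []) (mset (x # leaves ls)) + image_mset shape (mset ls)"
  by (induction ls rule: leaves.induct) (simp_all add: multiset.map_comp del: nest_tree.simps(2))

lemma eq_if_mset_eq_sorted_key:
  assumes "mset xs = mset ys" "inj f" "sorted (map f xs)" "sorted (map f ys)"
  shows "xs = ys"
  using assms sort_key_inj_key_eq by (metis inj_on_subset subset_UNIV)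

lemma inj_on_nest_vars_MNE: "inj_on (\<lambda>u. mset (nest_vars u)) MNE"
proof (rule inj_onI)
  fix u v :: "('x::linorder, 'o::linorder) mtree"
  assume in_MNE: "u \<in> MNE" "v \<in> MNE" and vars: "mset (nest_vars u) = mset (nest_vars v)"
  obtain ls x where u_eq: "u = nest_tree ls x" using in_MNE(1) by (rule MNE_imp_nest_tree)
  obtain ms y where v_eq: "v = nest_tree ms y" using in_MNE(2) by (rule MNE_imp_nest_tree)
  have fst_shape: "fst (shape l) \<noteq> []" for l :: "('x, 'o) level"
    by (cases l) simp
  have "mset (x # leaves ls) = mset (y # leaves ms)"
    using arg_cong[OF vars, of "\<lambda>M. image_mset snd (filter_mset (\<lambda>v. fst v = []) M)"]
    by (simp add: u_eq v_eq mset_nest_vars filter_mset_image_mset multiset.map_comp comp_def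
        fst_shape)
  moreover have "sorted (rev (x # leaves ls))" "sorted (rev (y # leaves ms))"
    using in_MNE by (simp_all only: u_eq v_eq nest_tree_in_MNE_iff)
  ultimately have "rev (x # leaves ls) = rev (y # leaves ms)"
    by (intro eq_if_mset_eq_sorted_key[of _ _ id]) simp_all
  moreover have "mset (map shape ls) = mset (map shape ms)"
    using arg_cong[OF vars, of "filter_mset (\<lambda>v. fst v \<noteq> [])"]
    by (simp add: u_eq v_eq mset_nest_vars filter_mset_image_mset fst_shape)
  then have "map shape ls = map shape ms"
    by (rule eq_if_mset_eq_sorted_key[OF _ inj_shape_key])
      (use in_MNE in \<open>simp_all only: u_eq v_eq nest_tree_in_MNE_iff map_map\<close>)
  ultimately show "u = v"
    using refill_leaves[of ls ms] refill_leaves[of ls ls] by (simp add: u_eq v_eq)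
qed

lemma inj_on_lin_tree_eval_kMNE:
  "inj_on
     (lin_tree_eval kscale dpoly_tri (dvar []) :: _ \<Rightarrow> ('x::linorder, 'o::linorder, 'k::field) dpoly)
     kMNE"
  unfolding kMNE_def lin_tree_eval_def lin_ext_to_kscale
proof (rule inj_on_lin_ext_if_distinct_leading)
  let ?lead = "\<lambda>u :: ('x, 'o) mtree. list_monom (nest_vars u)"
  let ?h = "tree_eval dpoly_tri (dvar []) :: ('x, 'o) mtree \<Rightarrow> ('x, 'o, 'k) dpoly"
  show "inj_on ?lead MNE"
    using inj_on_nest_vars_MNE list_monom_eqD unfolding inj_on_def by blast
  fix u :: "('x, 'o) mtree"
  assume "u \<in> MNE"
  then obtain ls x where "u = nest_tree ls x"
    by (rule MNE_imp_nest_tree)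
  then have leading: "leading_monom (?h u) (?lead u)"
    by (simp only: leading_monom_nest_tree)
  then show "?lead u \<in> Poly_Mapping.keys (?h u)"
    by (rule leading_monom_in_keys)
  show "underived m < underived (?lead u)" if "m \<in> Poly_Mapping.keys (?h u)" "m \<noteq> ?lead u" for m
    using leading that by (rule leading_monom_underived_less)
qed

end

section \<open>The free algebra as a quotient of the tree algebra\<close>

lemma tree_tri_bilinear:
  "tree_tri w (p + p') q = tree_tri w p q + tree_tri w p' q"
  "tree_tri w p (q + q') = tree_tri w p q + tree_tri w p q'"
  "tree_tri w (kscale c p) q = kscale c (tree_tri w p q)"
  "tree_tri w p (kscale c q) = kscale c (tree_tri w p q)"
  using linear_tree_tri_left[of w q] linear_tree_tri_right[of w p]
  by (simp_all add: Vector_Spaces.linear_iff)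

context nc_multi_novikov
begin

lemma linear_lin_tree_eval: "Vector_Spaces.linear kscale scale (lin_tree_eval scale tri g)"
  unfolding lin_tree_eval_def by (rule linear_lin_ext_to)

lemma lin_tree_eval_basis_elem: "lin_tree_eval scale tri g (basis_elem u) = tree_eval tri g u"
  by (simp add: lin_tree_eval_def lin_ext_to_def)

lemma lin_tree_eval_tree_tri:
  "lin_tree_eval scale tri g (tree_tri w p q) =
     tri w (lin_tree_eval scale tri g p) (lin_tree_eval scale tri g q)"
proof -
  interpret lin: Vector_Spaces.linear kscale scale "lin_tree_eval scale tri g"
    by (rule linear_lin_tree_eval)
  show ?thesis
  proof (induction p rule: kspace_induct)
    case (basis u)
    show ?case
    proof (induction q rule: kspace_induct)
      case (basis v)
      show ?case by (simp add: lin_tree_eval_basis_elem tree_eval_graft)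
    qed (simp_all add: tree_tri_bilinear tri_right_linear lin.add lin.scale)
  qed (simp_all add: tree_tri_bilinear tri_left_linear lin.add lin.scale)
qed

lemma lin_tree_eval_J:
  assumes "p \<in> J"
  shows "lin_tree_eval scale tri g p = 0"
proof -
  let ?H = "lin_tree_eval scale tri g"
  interpret lin: Vector_Spaces.linear kscale scale ?H
    by (rule linear_lin_tree_eval)
  have "novikov_relators \<subseteq> {p. ?H p = 0}"
    unfolding novikov_relators_def
  proof safe
    fix w t x y z
    show "?H (tree_tri t (tree_tri w x y) z - tree_tri w x (tree_tri t y z)
        - tree_tri t (tree_tri w y x) z + tree_tri w y (tree_tri t x z)) = 0"
      using left_symmetric[of t w "?H x" "?H y" "?H z"]
      by (simp add: lin.add lin.diff lin_tree_eval_tree_tri)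
    show "?H (tree_tri t (tree_tri w x y) z - tree_tri w (tree_tri t x z) y) = 0"
      using right_commutative[of t w "?H x" "?H y" "?H z"]
      by (simp add: lin.add lin.diff lin_tree_eval_tree_tri)
  qed
  moreover have "two_sided_ideal kscale tree_tri {p. ?H p = 0}"
    by (auto simp: two_sided_ideal_def lin.subspace_kernel lin_tree_eval_tree_tri
        tri_left_linear tri_right_linear)
  ultimately have "J \<subseteq> {p. ?H p = 0}"
    unfolding J_def by (rule hull_minimal)
  with assms show ?thesis by blast
qed

end

lemma coset_simps:
  "coset (p + q) = coset p + coset q" "coset (p - q) = coset p - coset q"
  "coset (kscale c p) = nov_scale c (coset p)"
  "coset (tree_tri w p q) = nov_tri w (coset p) (coset q)"
  by (transfer, rule cong_J_refl)+

lemma coset_eq_iff: "coset p = coset q \<longleftrightarrow> p - q \<in> J"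
  by transfer (simp add: cong_J_def)

lemma coset_rep_nov [simp]: "coset (rep_nov c) = c"
  by (metis Quotient3_abs_rep Quotient3_nov coset.abs_eq)

abbreviation tree_coset :: "('x, 'o) mtree \<Rightarrow> ('x, 'o, 'k::field) nov" where
  "tree_coset u \<equiv> coset (basis_elem u)"

lemma coset_cases [cases type: nov]:
  obtains p where "c = coset p"
  by (metis coset_rep_nov)

lemma vector_space_nov: "vector_space (nov_scale :: 'k::field \<Rightarrow> ('x, 'o, 'k) nov \<Rightarrow> _)"
proof
  fix a b :: 'k and x y :: "('x, 'o, 'k) nov"
  show "nov_scale a (x + y) = nov_scale a x + nov_scale a y"
    by transfer (simp add: kspace.scale_right_distrib cong_J_refl)
  show "nov_scale (a + b) x = nov_scale a x + nov_scale b x"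
    by transfer (simp add: kspace.scale_left_distrib cong_J_refl)
  show "nov_scale a (nov_scale b x) = nov_scale (a * b) x"
    by transfer (simp add: cong_J_refl)
  show "nov_scale 1 x = x"
    by transfer (simp add: cong_J_refl)
qed

lemma linear_coset: "Vector_Spaces.linear kscale nov_scale coset"
  by (simp add: Vector_Spaces.linear_iff vector_space_kscale vector_space_nov coset_simps)

lemma nc_multi_novikov_nov:
  "nc_multi_novikov nov_scale (nov_tri :: 'o \<Rightarrow> ('x, 'o, 'k::field) nov \<Rightarrow> _)"
proof -
  interpret vector_space "nov_scale :: 'k \<Rightarrow> ('x, 'o, 'k) nov \<Rightarrow> _" by (rule vector_space_nov)
  show ?thesis
  proof unfold_locales
    fix w t :: 'o and a b c :: "('x, 'o, 'k) nov" and k :: 'k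
    obtain x y z where abc_eq: "a = coset x" "b = coset y" "c = coset z"
      by (metis coset_rep_nov)
    show "nov_tri w a (b + c) = nov_tri w a b + nov_tri w a c"
      "nov_tri w (a + b) c = nov_tri w a c + nov_tri w b c"
      "nov_tri w a (nov_scale k b) = nov_scale k (nov_tri w a b)"
      "nov_tri w (nov_scale k a) b = nov_scale k (nov_tri w a b)"
      unfolding abc_eq coset_simps[symmetric] by (simp_all add: tree_tri_bilinear)
    have "tree_tri t (tree_tri w x y) z - tree_tri w x (tree_tri t y z)
        - tree_tri t (tree_tri w y x) z + tree_tri w y (tree_tri t x z) \<in> J"
      unfolding J_def novikov_relators_def by (rule hull_inc) blast
    then show "nov_tri t (nov_tri w a b) c - nov_tri w a (nov_tri t b c) =
        nov_tri t (nov_tri w b a) c - nov_tri w b (nov_tri t a c)"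
      unfolding abc_eq coset_simps[symmetric] coset_eq_iff diff_diff_eq2 diff_add_eq .
    have "tree_tri t (tree_tri w x y) z - tree_tri w (tree_tri t x z) y \<in> J"
      unfolding J_def novikov_relators_def by (rule hull_inc) blast
    then show "nov_tri t (nov_tri w a b) c = nov_tri w (nov_tri t a c) b"
      unfolding abc_eq coset_simps[symmetric] coset_eq_iff .
  qed
qed

definition nov_eval ::
    "('k::field \<Rightarrow> 'm::ab_group_add \<Rightarrow> 'm) \<Rightarrow> ('o \<Rightarrow> 'm \<Rightarrow> 'm \<Rightarrow> 'm) \<Rightarrow> ('x \<Rightarrow> 'm) \<Rightarrow>
     ('x, 'o, 'k) nov \<Rightarrow> 'm" where
  "nov_eval scale tri g c = lin_tree_eval scale tri g (rep_nov c)"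

lemma tree_coset_eq_tree_eval:
  "tree_coset u = tree_eval nov_tri (\<lambda>x. tree_coset (vertex x)) u"
proof (induction u rule: mtree_graft_induct)
  case (graft w u v)
  then show ?case
    unfolding tree_tri_basis_elem[symmetric] coset_simps tree_eval_graft by simp
qed simp

context nc_multi_novikov
begin

lemma nov_eval_coset: "nov_eval scale tri g (coset p) = lin_tree_eval scale tri g p"
proof -
  interpret lin: Vector_Spaces.linear kscale scale "lin_tree_eval scale tri g"
    by (rule linear_lin_tree_eval)
  have "rep_nov (coset p) - p \<in> J"
    by (simp flip: coset_eq_iff)
  then show ?thesis
    using lin_tree_eval_J[of "rep_nov (coset p) - p" g] by (simp add: nov_eval_def lin.diff)
qed

lemma nmn_hom_nov_eval: "nmn_hom nov_scale nov_tri scale tri (nov_eval scale tri g)"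
proof -
  interpret lin: Vector_Spaces.linear kscale scale "lin_tree_eval scale tri g"
    by (rule linear_lin_tree_eval)
  have "nov_eval scale tri g (c + d) = nov_eval scale tri g c + nov_eval scale tri g d"
    "nov_eval scale tri g (nov_scale k c) = scale k (nov_eval scale tri g c)"
    "nov_eval scale tri g (nov_tri w c d) = tri w (nov_eval scale tri g c) (nov_eval scale tri g d)"
    for c d k w
    by (cases c; cases d;
        simp add: nov_eval_coset lin.add lin.scale lin_tree_eval_tree_tri flip: coset_simps)+
  then show ?thesis
    by (simp add: nmn_hom_def Vector_Spaces.linear_iff vector_space_nov vector_space_axioms)
qed

lemma nov_eval_vertex: "nov_eval scale tri g (tree_coset (vertex x)) = g x"
  by (simp add: nov_eval_coset lin_tree_eval_basis_elem)

lemma nmn_hom_eq_nov_eval: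
  assumes "nmn_hom nov_scale nov_tri scale tri h" "\<And>x. h (tree_coset (vertex x)) = g x"
  shows "h = nov_eval scale tri g"
proof -
  have "Vector_Spaces.linear kscale scale (\<lambda>p. h (coset p))"
    using assms(1) linear_coset by (auto simp: nmn_hom_def Vector_Spaces.linear_iff)
  moreover have "h (tree_coset u) = tree_eval tri g u" for u
    unfolding tree_coset_eq_tree_eval[of u] nmn_hom_tree_eval[OF assms(1)] assms(2) ..
  ultimately have "h (coset p) = nov_eval scale tri g (coset p)" for p
    using linear_eq_lin_ext_to[of "\<lambda>p. h (coset p)" p]
    by (simp add: nov_eval_coset lin_tree_eval_def)
  then show ?thesis
    by (metis ext coset_rep_nov)
qed

end

lemma free_nov:
  "free_nc_multi_novikov target nov_scale
     (nov_tri :: 'o \<Rightarrow> ('x, 'o, 'k::field) nov \<Rightarrow> _) (\<lambda>x. tree_coset (vertex x))"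
  unfolding free_nc_multi_novikov_def
proof (intro conjI allI impI nc_multi_novikov_nov)
  fix scale :: "'k \<Rightarrow> 'm::ab_group_add \<Rightarrow> 'm" and tri :: "'o \<Rightarrow> 'm \<Rightarrow> 'm \<Rightarrow> 'm" and g :: "'x \<Rightarrow> 'm"
  assume "nc_multi_novikov scale tri"
  then interpret nc_multi_novikov scale tri .
  show "\<exists>!h. nmn_hom nov_scale nov_tri scale tri h \<and> (\<forall>x. h (tree_coset (vertex x)) = g x)"
  proof (rule ex1I)
    show "nmn_hom nov_scale nov_tri scale tri (nov_eval scale tri g) \<and>
        (\<forall>x. nov_eval scale tri g (tree_coset (vertex x)) = g x)"
      by (simp add: nmn_hom_nov_eval nov_eval_vertex)
  qed (blast intro: nmn_hom_eq_nov_eval)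
qed

section \<open>The basis of noncommuting multi-Novikov elements\<close>

lemma inj_on_coset_kMNE:
  "inj_on coset (kMNE :: (('x::linorder, 'o::linorder) mtree \<Rightarrow>\<^sub>0 'k::field) set)"
proof (rule inj_onI)
  fix p q :: "('x, 'o) mtree \<Rightarrow>\<^sub>0 'k"
  assume in_kMNE: "p \<in> kMNE" "q \<in> kMNE" and "coset p = coset q"
  then have "nov_eval kscale dpoly_tri (dvar []) (coset p) =
      (nov_eval kscale dpoly_tri (dvar []) (coset q) :: ('x, 'o, 'k) dpoly)"
    by simp
  then have "lin_tree_eval kscale dpoly_tri (dvar []) p =
      (lin_tree_eval kscale dpoly_tri (dvar []) q :: ('x, 'o, 'k) dpoly)"
    by (simp only: nc_multi_novikov.nov_eval_coset[OF nc_multi_novikov_dpoly])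
  then show "p = q"
    using inj_on_lin_tree_eval_kMNE in_kMNE by (metis inj_onD)
qed

lemma span_tree_coset_MNE:
  "module.span nov_scale (tree_coset ` MNE) =
     (UNIV :: ('x::linorder, 'o::linorder, 'k::field) nov set)"
proof -
  interpret nov: nc_multi_novikov nov_scale "nov_tri :: 'o \<Rightarrow> ('x, 'o, 'k) nov \<Rightarrow> _"
    by (rule nc_multi_novikov_nov)
  have "coset p \<in> nov.span (tree_coset ` MNE)" for p :: "('x, 'o) mtree \<Rightarrow>\<^sub>0 'k"
  proof (induction p rule: kspace_induct)
    case (basis u)
    show ?case
      using tree_eval_in_span_MNE[OF nc_multi_novikov_nov, of "\<lambda>x. tree_coset (vertex x)" u]
      by (simp flip: tree_coset_eq_tree_eval)
  qed (simp_all add: coset_simps nov.span_add nov.span_scale)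
  then show ?thesis
    by (metis UNIV_eq_I coset_rep_nov)
qed

lemma coset_image_kMNE: "coset ` kMNE = (UNIV :: ('x::linorder, 'o::linorder, 'k::field) nov set)"
proof -
  interpret Vector_Spaces.linear kscale nov_scale "coset :: _ \<Rightarrow> ('x, 'o, 'k) nov"
    by (rule linear_coset)
  show ?thesis
    using span_image[of "basis_elem ` MNE"] by (simp add: kMNE_def image_image span_tree_coset_MNE)
qed

lemma inj_on_tree_coset_MNE:
  "inj_on (tree_coset :: _ \<Rightarrow> ('x::linorder, 'o::linorder, 'k::field) nov) MNE"
proof -
  have "inj_on (basis_elem :: ('x, 'o) mtree \<Rightarrow> _ \<Rightarrow>\<^sub>0 'k) MNE"
    by (rule inj_onI) (metis keys_single singleton_inject zero_neq_one)
  moreover have "inj_on coset (basis_elem ` MNE :: (('x, 'o) mtree \<Rightarrow>\<^sub>0 'k) set)"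
    using inj_on_coset_kMNE by (rule inj_on_subset) (auto simp: kMNE_def kspace.span_base)
  ultimately show ?thesis
    using comp_inj_on by (auto simp: comp_def)
qed

lemma independent_tree_coset_MNE:
  "\<not> module.dependent nov_scale
     ((tree_coset :: _ \<Rightarrow> ('x::linorder, 'o::linorder, 'k::field) nov) ` MNE)"
proof -
  interpret Vector_Spaces.linear kscale nov_scale "coset :: _ \<Rightarrow> ('x, 'o, 'k) nov"
    by (rule linear_coset)
  show ?thesis
    using independent_injective_image[OF independent_basis_elem]
      inj_on_coset_kMNE[unfolded kMNE_def]
    by (simp add: image_image)
qed

section \<open>The isomorphism with differential polynomials\<close>

lemma vector_space_pcd: "vector_space (pcd_scale :: 'k::field \<Rightarrow> ('x, 'o, 'k) pcd \<Rightarrow> _)"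
proof
  fix a b :: "('x, 'o, 'k) pcd" and k l :: 'k
  show "pcd_scale k (a + b) = pcd_scale k a + pcd_scale k b"
    by transfer (rule kspace.scale_right_distrib)
  show "pcd_scale (k + l) a = pcd_scale k a + pcd_scale l a"
    by transfer (rule kspace.scale_left_distrib)
  show "pcd_scale k (pcd_scale l a) = pcd_scale (k * l) a"
    by transfer simp
  show "pcd_scale 1 a = a"
    by transfer simp
qed

lemma nc_multi_novikov_pcd:
  "nc_multi_novikov pcd_scale (pcd_tri :: 'o \<Rightarrow> ('x, 'o, 'k::field) pcd \<Rightarrow> _)"
proof -
  interpret dpoly: nc_multi_novikov kscale "dpoly_tri :: 'o \<Rightarrow> ('x, 'o, 'k) dpoly \<Rightarrow> _"
    by (rule nc_multi_novikov_dpoly)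
  interpret vector_space "pcd_scale :: 'k \<Rightarrow> ('x, 'o, 'k) pcd \<Rightarrow> _" by (rule vector_space_pcd)
  show ?thesis
  proof unfold_locales
    fix w t :: 'o and a b c :: "('x, 'o, 'k) pcd" and k :: 'k
    show "pcd_tri w a (b + c) = pcd_tri w a b + pcd_tri w a c"
      "pcd_tri w (a + b) c = pcd_tri w a c + pcd_tri w b c"
      "pcd_tri w a (pcd_scale k b) = pcd_scale k (pcd_tri w a b)"
      "pcd_tri w (pcd_scale k a) b = pcd_scale k (pcd_tri w a b)"
      by (transfer, simp add: dpoly.tri_left_linear dpoly.tri_right_linear)+
    show "pcd_tri t (pcd_tri w a b) c - pcd_tri w a (pcd_tri t b c) =
        pcd_tri t (pcd_tri w b a) c - pcd_tri w b (pcd_tri t a c)"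
      by transfer (rule dpoly.left_symmetric)
    show "pcd_tri t (pcd_tri w a b) c = pcd_tri w (pcd_tri t a c) b"
      by transfer (rule dpoly.right_commutative)
  qed
qed

lemma nmn_hom_Rep_pcd:
  "nmn_hom pcd_scale pcd_tri kscale dpoly_tri (Rep_pcd :: ('x, 'o, 'k::field) pcd \<Rightarrow> _)"
  by (simp add: nmn_hom_def Vector_Spaces.linear_iff vector_space_pcd vector_space_kscale
      plus_pcd.rep_eq pcd_scale.rep_eq pcd_tri.rep_eq)

lemma nmn_iso_nov_pcd:
  fixes f :: "('x::linorder, 'o::linorder, 'k::field) nov \<Rightarrow> ('x, 'o, 'k) pcd"
  assumes hom: "nmn_hom nov_scale nov_tri pcd_scale pcd_tri f"
    and var: "\<And>x. f (tree_coset (vertex x)) = pcd_var x"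
  shows "nmn_iso nov_scale nov_tri pcd_scale pcd_tri f"
proof -
  interpret dpoly: nc_multi_novikov kscale "dpoly_tri :: 'o \<Rightarrow> ('x, 'o, 'k) dpoly \<Rightarrow> _"
    by (rule nc_multi_novikov_dpoly)
  have Rep_hom: "nmn_hom nov_scale nov_tri kscale dpoly_tri (\<lambda>c. Rep_pcd (f c))"
    using hom nmn_hom_Rep_pcd by (rule nmn_hom_comp)
  have Rep_coset: "Rep_pcd (f (coset p)) = lin_tree_eval kscale dpoly_tri (dvar []) p" for p
    using dpoly.nmn_hom_eq_nov_eval[OF Rep_hom, of "dvar []"]
    by (simp add: fun_eq_iff var pcd_var.rep_eq dpoly.nov_eval_coset)
  have "inj f"
  proof (rule injI)
    fix c d assume "f c = f d"
    moreover obtain p q where "c = coset p" "p \<in> kMNE" "d = coset q" "q \<in> kMNE"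
      using coset_image_kMNE by (metis UNIV_I imageE)
    ultimately show "c = d"
      using Rep_coset inj_on_lin_tree_eval_kMNE by (metis inj_onD)
  qed
  moreover have "PCD_set \<subseteq> range (\<lambda>c. Rep_pcd (f c))"
    unfolding PCD_set_def
  proof (rule hull_minimal)
    show "range (dvar []) \<subseteq> range (\<lambda>c. Rep_pcd (f c))"
      using var pcd_var.rep_eq by (metis image_subsetI rangeI)
  qed (rule subalgebra_range_nmn_hom[OF Rep_hom])
  then have "y \<in> range f" for y
    using Rep_pcd[of y] by (auto simp: Rep_pcd_inject)
  ultimately show ?thesis
    using hom by (auto simp: nmn_iso_def bij_def)
qed

lemma ex1_nmn_hom_nov_pcd:
  "\<exists>!f :: ('x, 'o, 'k::field) nov \<Rightarrow> ('x, 'o, 'k) pcd.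
     nmn_hom nov_scale nov_tri pcd_scale pcd_tri f \<and>
     (\<forall>x. f (tree_coset (vertex x)) = pcd_var x)"
  using free_nov nc_multi_novikov_pcd unfolding free_nc_multi_novikov_def by blast

lemma free_pcd:
  "free_nc_multi_novikov target
     (pcd_scale :: 'k::field \<Rightarrow> ('x::linorder, 'o::linorder, 'k) pcd \<Rightarrow> _) pcd_tri pcd_var"
proof -
  obtain f :: "('x, 'o, 'k) nov \<Rightarrow> ('x, 'o, 'k) pcd"
    where "nmn_hom nov_scale nov_tri pcd_scale pcd_tri f"
      and var: "\<And>x. f (tree_coset (vertex x)) = pcd_var x"
    using ex1_nmn_hom_nov_pcd by blast
  then have "nmn_iso nov_scale nov_tri pcd_scale pcd_tri f"
    by (rule nmn_iso_nov_pcd)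
  from free_nc_multi_novikov_iso[OF free_nov this nc_multi_novikov_pcd] show ?thesis
    by (simp add: var)
qed

theorem theorem4p8:
  fixes target :: "'m::ab_group_add itself"
    and \<eta> :: "(('x::linorder, 'o::linorder) mtree \<Rightarrow>\<^sub>0 'k::field) \<Rightarrow> ('x, 'o, 'k) nov"
    and \<nu> :: "('x, 'o) mtree \<Rightarrow> ('x, 'o, 'k) nov"
  defines "\<eta> \<equiv> coset"
    and "\<nu> \<equiv> (\<lambda>u. coset (basis_elem u))"
  shows
    "(Vector_Spaces.linear kscale nov_scale \<eta> \<and> bij_betw \<eta> kMNE UNIV) \<and>
     (free_nc_multi_novikov target nov_scale nov_tri (\<lambda>x. \<nu> (vertex x)) \<and>
        inj_on \<nu> MNE \<and>
        \<not> module.dependent nov_scale (\<nu> ` MNE) \<and>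
        module.span nov_scale (\<nu> ` MNE) = UNIV) \<and>
     (\<exists>!f :: ('x, 'o, 'k) nov \<Rightarrow> ('x, 'o, 'k) pcd.
        nmn_hom nov_scale nov_tri pcd_scale pcd_tri f \<and> (\<forall>x. f (\<nu> (vertex x)) = pcd_var x)) \<and>
     (\<forall>f :: ('x, 'o, 'k) nov \<Rightarrow> ('x, 'o, 'k) pcd.
        nmn_hom nov_scale nov_tri pcd_scale pcd_tri f \<and> (\<forall>x. f (\<nu> (vertex x)) = pcd_var x) \<longrightarrow>
        nmn_iso nov_scale nov_tri pcd_scale pcd_tri f) \<and>
     free_nc_multi_novikov target
       (pcd_scale :: 'k \<Rightarrow> ('x, 'o, 'k) pcd \<Rightarrow> ('x, 'o, 'k) pcd) pcd_tri pcd_var"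
  unfolding \<eta>_def \<nu>_def
proof (intro conjI allI impI)
  show "bij_betw coset (kMNE :: (('x, 'o) mtree \<Rightarrow>\<^sub>0 'k) set) UNIV"
    unfolding bij_betw_def using inj_on_coset_kMNE coset_image_kMNE by (rule conjI)
  show "nmn_iso nov_scale nov_tri pcd_scale pcd_tri f"
    if "nmn_hom nov_scale nov_tri pcd_scale pcd_tri f \<and>
      (\<forall>x. f (tree_coset (vertex x)) = pcd_var x)"
    for f :: "('x, 'o, 'k) nov \<Rightarrow> ('x, 'o, 'k) pcd"
    using that nmn_iso_nov_pcd by blast
qed (fact linear_coset free_nov inj_on_tree_coset_MNE independent_tree_coset_MNE span_tree_coset_MNE
      ex1_nmn_hom_nov_pcd free_pcd)+

end
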